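(* Let $\mathcal{Q}_o^*$ be the optimal value of the nonlinear two-stage distributionally robust problem $\mathcal{Q}_o$ (DR-OTSGMD), i.e. the minimum worst-case expected total cost, and let $\mathcal{Q}_v^*$ be the optimal value of the formulation $\mathcal{Q}_v$ built from its linearized version and from the vertices of the inner polyhedral support $\Omega'$ (all formulations as defined in the context). Then solving $\mathcal{Q}_v$ yields a lower bound for $\mathcal{Q}_o$: $$\mathcal{Q}_v^*\le \mathcal{Q}_o^* .$$
   Context: Optimal values are infima (suprema) in the extended reals. **Network data.** $\mathcal N^a,\mathcal N^d$ are finite sets of AC and DC nodes; $\mathcal E^a,\mathcal E^d$ finite sets of AC and DC edges ($e=e_{ij}$ joins $i$ and $j$); $\mathcal G$ is the finite set of generators, $\mathcal G_i\subseteq\mathcal G$ those at bus $i$; $\mathcal E_i$ is the set of edges incident to node $i$ (AC or DC); $\mathcal E^\tau\subseteq\mathcal E^a$ is the set of transformers; $\mathcal E^\tau_i\subseteq\mathcal E^\tau$ are the transformers whose losses are charged to bus $i$. A map $e\mapsto\overrightarrow e$ from $\mathcal E^d$ to $\mathcal E^a$ gives the AC line associated with a DC edge. Real parameters: costs $c_i^0,c_i^1,c_i^2,c_i^{R1},c_i^{R2},\kappa_i\ge0$; $g_e,b_e,b^c_e,g_i,b_i,d^p_i,d^q_i$; tap ratios $\alpha_{ij}>0$; thermal limits $s_e$; $\overline\theta\in(0,\pi/2)$; voltage bounds $0<\underline v_i\le\overline v_i$; generation bounds $\underline{gp}_i\le\overline{gp}_i$, $\underline{gq}_i\le\overline{gq}_i$;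 ramp fractions $\overline u_i^R$; DC line admittances $a_e$ and grounding admittances $a_m$ ($a_m=0$ if node $m$ is not a substation neutral); loss factors $k_e$; line displacements $L_e^N,L_e^E$; $\overline I_e^a=s_e/\min\{\underline v_i,\underline v_j\}$ for $e=e_{ij}$; $M=\max_{e\in\mathcal E^a}2\overline I^a_e$. Random vector $\widetilde\omega=[\widetilde\nu^E,\widetilde\nu^N]^T$ (eastward and northward geo-electric field); the induced voltage source on $e\in\mathcal E^d$ is $\widetilde\nu^d_e=\widetilde\nu^N L_e^N+\widetilde\nu^E L_e^E$. For a transformer $e\in\mathcal E^\tau$, $S_e$ denotes the following linear function of the winding currents: $I_h^d$ (generator step-up); $((\alpha-1)I_s^d+I_c^d)/\alpha$ (GWye-GWye auto-transformer, with series/common windings $s,c$ and turns ratio $\alpha$); $(\alpha I_h^d+I_l^d)/\alpha$ (Gwye-Gwye, with high/low-side windings $h,l$ and turns ratio $\alpha$); $0$ for ungrounded three-winding transformers. **First stage.** Decisions $z^a_e\in\{0,1\}$ ($e\in\mathcal E^a$), $z^g_i\in\{0,1\}$, $\rho_i$ ($i\in\mathcal G$) with $z_i^g\underline{gp}_i\le\rho_i\le z_i^g\overline{gp}_i$. **Nonlinear second stage.** $\mathcal H^o(z^a,z^g,\rho,\widetilde\omega)$ is the minimum of $$\sum_{i\in\mathcal G}\big(c_i^{R2}(\Delta_i)^2+c_i^{R1}\Delta_i\big)+\sum_{i\in\mathcal N^a}\kappa_i(l_i^{p+}+l_i^{q+}+l_i^{p-}+l_i^{q-})$$ over $\Delta,f^p,f^q,p,q,v,\theta$,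 $l^{p\pm},l^{q\pm}\ge0$, $v^d,I^d,\widetilde I^d,d^{qloss}$ subject to: - (generators) $\Delta_i\ge0$, $\Delta_i\ge f_i^p-\rho_i$; $z_i^g\underline{gp}_i\le f^p_i\le z_i^g\overline{gp}_i$; $z_i^g\underline{gq}_i\le f^q_i\le z_i^g\overline{gq}_i$; $|f_i^p-\rho_i|\le z_i^g\overline u_i^R\overline{gp}_i$ for $i\in\mathcal G$; - (voltage) $\underline v_i\le v_i\le\overline v_i$ for $i\in\mathcal N^a$; - (balance, $i\in\mathcal N^a$) $\sum_{e_{ij}\in\mathcal E_i}p_{ij}=\sum_{k\in\mathcal G_i}f_k^p-d_i^p+l_i^{p+}-l_i^{p-}-v_i^2g_i$ and $\sum_{e_{ij}\in\mathcal E_i}q_{ij}=\sum_{k\in\mathcal G_i}f_k^q-d_i^q-d_i^{qloss}+l_i^{q+}-l_i^{q-}+v_i^2b_i$ (flows measured at $i$); - (AC flow, $e=e_{ij}\in\mathcal E^a$, $\theta_{ij}=\theta_i-\theta_j$) $p_{ij}=z_e^a\big(\tfrac{1}{\alpha_{ij}^2}g_ev_i^2-\tfrac1{\alpha_{ij}}v_iv_j(g_e\cos\theta_{ij}+b_e\sin\theta_{ij})\big)$, $q_{ij}=z_e^a\big(-\tfrac1{\alpha_{ij}^2}(b_e+\tfrac{b_e^c}2)v_i^2+\tfrac1{\alpha_{ij}}v_iv_j(b_e\cos\theta_{ij}-g_e\sin\theta_{ij})\big)$, $p_{ji}=z_e^a\big(g_ev_j^2-\tfrac1{\alpha_{ij}}v_iv_j(g_e\cos\theta_{ij}-b_e\sin\theta_{ij})\big)$,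 $q_{ji}=z_e^a\big(-(b_e+\tfrac{b_e^c}2)v_j^2+\tfrac1{\alpha_{ij}}v_iv_j(b_e\cos\theta_{ij}+g_e\sin\theta_{ij})\big)$; - (limits, $e=e_{ij}\in\mathcal E^a$) $z_e^a|\theta_i-\theta_j|\le\overline\theta$; $p_{ij}^2+q_{ij}^2\le z_e^as_e^2$; $p_{ji}^2+q_{ji}^2\le z_e^as_e^2$; - (GIC) $\sum_{e\in\mathcal E_m}I_e^d=a_mv_m^d$ for $m\in\mathcal N^d$ (currents counted with the orientation sign of Kirchhoff's law); $I_e^d=z^a_{\overrightarrow e}a_e(v_m^d-v_n^d+\widetilde\nu_e^d)$ for $e_{mn}\in\mathcal E^d$; $\widetilde I_e^d\ge S_e$, $\widetilde I_e^d\ge-S_e$, $0\le\widetilde I_e^d\le M$ for $e\in\mathcal E^\tau$; $d_i^{qloss}=\sum_{e\in\mathcal E_i^\tau}k_ev_i\widetilde I_e^d$ for $i\in\mathcal N^a$. **Uncertainty.** For given $\overline\nu^M>0$ and $\mu=[\mu^E,\mu^N]^T$, $$\Omega=\{(\widetilde\nu^E,\widetilde\nu^N)\in\mathbb R^2:0\le\widetilde\nu^N\le\overline\nu^M,\ -\overline\nu^M\le\widetilde\nu^E\le\overline\nu^M,\ (\widetilde\nu^N)^2+(\widetilde\nu^E)^2\le(\overline\nu^M)^2\},$$ and $\mathbb Q$ is the set of probability distributions $\mathbb P$ on $\mathbb R^2$ with $\mathbb E_{\mathbb P}[\widetilde\omega]=\mu$ and $\mathbb P(\widetilde\omega\in\Omega)=1$.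 Expectations below are assumed well defined. **Problem $\mathcal Q_o$.** Over first-stage decisions, $$\mathcal Q_o:\quad\min\ \sum_{i\in\mathcal G}\big(z_i^gc_i^0+c_i^1\rho_i+c_i^2(\rho_i)^2\big)+\sup_{\mathbb P\in\mathbb Q}\mathbb E_{\mathbb P}[\mathcal H^o(z^a,z^g,\rho,\widetilde\omega)].$$ **Linearized version.** For variables with bounds $\underline x_i\le x_i\le\overline x_i$, $\underline x_j\le x_j\le\overline x_j$, the McCormick set $\langle x_i,x_j\rangle^{MC}$ consists of all $x_{ij}$ with $x_{ij}\ge\underline x_ix_j+\underline x_jx_i-\underline x_i\underline x_j$, $x_{ij}\ge\overline x_ix_j+\overline x_jx_i-\overline x_i\overline x_j$, $x_{ij}\le\underline x_ix_j+\overline x_jx_i-\underline x_i\overline x_j$, $x_{ij}\le\overline x_ix_j+\underline x_jx_i-\overline x_i\underline x_j$ (together with the bounds). $L_x$ denotes a finite set of uniformly located points within the bounds of the variable $x$. - In the first-stage cost $\rho_i^2$ is replaced by a new first-stage variable $\check\rho_i$ with $\check\rho_i\ge2\rho_i\ell-z_i^g\ell^2$ for all $\ell\in L_{\rho_i}$. - In the second-stage cost $\Delta_i^2$ is replaced by a new variable $\check\Delta_i$ with $\check\Delta_i\ge2\ell\Delta_i-z_i^g\ell^2$ for all $\ell\in L_{\Delta_i}$. - $v_i^2$ is replaced by $w_i$ with $w_i\le(\overline v_i+\underline v_i)v_i-\overline v_i\underline v_i$ and $w_i\ge2\ell v_i-\ell^2$ for all $\ell\in L_{v_i}$. - $z_e^av_i^2$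 and $z_e^av_j^2$ are replaced by $w^z_{ie}\in\langle z^a_e,w_i\rangle^{MC}$ and $w^z_{je}\in\langle z_e^a,w_j\rangle^{MC}$, with $z_e^a\in[0,1]$ and $w_i\in[\underline v_i^2,\overline v_i^2]$. - $z_e^av_iv_j\cos(\theta_i-\theta_j)$ and $z_e^av_iv_j\sin(\theta_i-\theta_j)$ are replaced by $w_e^c,w_e^s$ with $z_e^a\underline w_e^c\le w_e^c\le z_e^a\overline w_e^c$, $z_e^a\underline w_e^s\le w_e^s\le z_e^a\overline w_e^s$, where $[\underline w^c_e,\overline w^c_e]$ and $[\underline w^s_e,\overline w^s_e]$ are valid bounds for $v_iv_j\cos(\theta_i-\theta_j)$, $v_iv_j\sin(\theta_i-\theta_j)$ under the voltage and angle limits; $-\tan(\overline\theta)w_e^c\le w_e^s\le\tan(\overline\theta)w_e^c$ (replacing the angle limit); and, in place of the rotated second-order cone constraint $(w_e^c)^2+(w_e^s)^2\le w^z_{ie}w^z_{je}$, the linear constraints $$2(w_e^c\ell^c+w_e^s\ell^s)-w^z_{ie}\ell^t-w^z_{je}\ell^f\le z_e^a\big((\ell^c)^2+(\ell^s)^2-\ell^f\ell^t\big)$$ for all $e=e_{ij}\in\mathcal E^a$, $\ell^c\in L_{w_e^c}$, $\ell^s\in L_{w_e^s}$, $\ell^f\in L_{w_i}$, $\ell^t\in L_{w_j}$. - The AC flow and balance equations become the linear equations obtained by these substitutions: $p_{ij}=\tfrac{1}{\alpha_{ij}^2}g_ew^z_{ie}-\tfrac1{\alpha_{ij}}(g_ew^c_e+b_ew^s_e)$,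 $q_{ij}=-\tfrac1{\alpha_{ij}^2}(b_e+\tfrac{b^c_e}2)w^z_{ie}+\tfrac1{\alpha_{ij}}(b_ew^c_e-g_ew^s_e)$, $p_{ji}=g_ew^z_{je}-\tfrac1{\alpha_{ij}}(g_ew^c_e-b_ew^s_e)$, $q_{ji}=-(b_e+\tfrac{b^c_e}2)w^z_{je}+\tfrac1{\alpha_{ij}}(b_ew^c_e+g_ew^s_e)$, and $v_i^2$ replaced by $w_i$ in the balances. - The thermal limits are replaced by $2p_{ij}\ell^p+2q_{ij}\ell^q\le z_e^a(s_e^2+(\ell^p)^2+(\ell^q)^2)$ and the same for $p_{ji},q_{ji}$, for all $\ell^p\in L_{p_e},\ell^q\in L_{q_e}$. - $v_i\widetilde I^d_e$ is replaced by $u_{ie}^d\in\langle v_i,\widetilde I_e^d\rangle^{MC}$ (bounds $[\underline v_i,\overline v_i]$ and $[0,M]$), so $d_i^{qloss}=\sum_{e\in\mathcal E_i^\tau}k_eu^d_{ie}$; and $z^a_{\overrightarrow e}(v_m^d-v_n^d)$ by $v^{zd}_{mn}\in\langle z^a_{\overrightarrow e},v_m^d-v_n^d\rangle^{MC}$, with finite bounds on $v_m^d-v_n^d$ that are valid (imposing them does not change the value of $\mathcal H^o$); so $I_e^d=a_ev_{mn}^{zd}+z^a_{\overrightarrow e}a_e\widetilde\nu_e^d$. All other constraints (including integrality of $z^a,z^g$) are kept. In standard form, with $y=(z^a,z^g,\rho,\check\rho)$, the first-stage linear constraints read $Ay\ge b$, the first-stage cost is $a^Ty$, and the linearized second stage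 is (sign-free variables being split) $$\mathcal H(y,\widetilde\omega)=\min_{x\ge0}\{c^Tx:\ Gy+Ex\ge h,\ T(\widetilde\omega)y=Wx\},\qquad T(\widetilde\omega)=\sum_{i=1}^2T^i\widetilde\omega_i,$$ where $T(\widetilde\omega)y=Wx$ collects the equations containing $\widetilde\omega$. Standing assumption: the linearized second stage is feasible for every feasible $y$ and every $\widetilde\omega\in\Omega$ (because of load shedding and over-generation), and the dual feasible set $\{(\gamma,\pi):E^T\gamma+W^T\pi\le c,\ \gamma\ge0\}$ is nonempty. **Formulation $\mathcal Q_v$.** $\Omega'\subseteq\Omega$ is a nonempty bounded polyhedron obtained by discretizing the curved boundary of $\Omega$ (bounded by linear cuts through finitely many points of the curve), and $\mathcal K$ is the set of its vertices $\widetilde\omega_j^*=(\widetilde\omega_{1j}^*,\widetilde\omega_{2j}^* )$. Then $$\mathcal Q_v:\quad\min_{y,\lambda,\eta}\ a^Ty+\mu^T\lambda+\eta\quad\text{s.t. } Ay\ge b,\ z^a,z^g\text{ binary},\ \lambda\in\mathbb R^2,\ \eta\in\mathbb R,\ \eta\ge V(y,\lambda),$$ where $$V(y,\lambda)=\max_{\gamma,\pi,\widetilde\omega,\beta,\zeta}\ (h-Gy)^T\gamma+y^T\Big(\sum_{i=1}^{2}\sum_{j=1}^{|\mathcal K|}(T^i)^T\zeta_j\widetilde\omega_{ij}^*\Big)-\lambda^T\widetilde\omega$$ subject to $E^T\gamma+W^T\pi\le c$, $\gamma\ge0$, $\zeta_{jl}\in\langle\beta_j,\pi_l\rangle^{MC}$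 for all $j$ and every component $l$ of $\pi$, $\widetilde\omega=\sum_j\beta_j\widetilde\omega_j^*$, $\sum_j\beta_j=1$, $\beta_j\in\{0,1\}$. The McCormick sets use $\beta_j\in[0,1]$ and finite bounds on the components $\pi_l$, so that $\zeta_j=\beta_j\pi$ exactly.
   Formalization: Added hypothesis: the linear constraints replacing the rotated second-order cone constraint remove no point (v_i², v_j², v_iv_j cos θ, v_iv_j sin θ) within the voltage and angle limits. For arbitrary sample grids this can fail, and then the stated lower bound can be false. *)

theory Defs
  imports "HOL-Analysis.Analysis" "HOL-Probability.Probability"
begin

section \<open>Network data\<close>

text \<open>Windings are DC edges; the real argument is the turns ratio.\<close>

datatype 'd transformer =
    Step_Up 'd                  \<comment> \<open>high side\<close>
  | Auto real 'd 'd             \<comment> \<open>series, common\<close>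
  | Gwye_Gwye real 'd 'd        \<comment> \<open>high side, low side\<close>
  | Ungrounded

record ('n, 'm, 'e, 'd, 'g) network =
  ac_nodes :: "'n set"
  dc_nodes :: "'m set"
  ac_edges :: "'e set"
  dc_edges :: "'d set"
  gens :: "'g set"
  src :: "'e \<Rightarrow> 'n"
  dst :: "'e \<Rightarrow> 'n"
  dsrc :: "'d \<Rightarrow> 'm"
  ddst :: "'d \<Rightarrow> 'm"
  ac_line :: "'d \<Rightarrow> 'e"
  gen_bus :: "'g \<Rightarrow> 'n"
  trafos :: "'e set"
  trafos_at :: "'n \<Rightarrow> 'e set"
  trafo_type :: "'e \<Rightarrow> 'd transformer"
  cost0 :: "'g \<Rightarrow> real"
  cost1 :: "'g \<Rightarrow> real"
  cost2 :: "'g \<Rightarrow> real"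
  costR1 :: "'g \<Rightarrow> real"
  costR2 :: "'g \<Rightarrow> real"
  shed_cost :: "'n \<Rightarrow> real"          \<comment> \<open>\<open>\<kappa>\<^sub>i\<close>\<close>
  cond :: "'e \<Rightarrow> real"               \<comment> \<open>\<open>g\<^sub>e\<close>\<close>
  susc :: "'e \<Rightarrow> real"               \<comment> \<open>\<open>b\<^sub>e\<close>\<close>
  charge :: "'e \<Rightarrow> real"             \<comment> \<open>line charging susceptance\<close>
  shunt_g :: "'n \<Rightarrow> real"
  shunt_b :: "'n \<Rightarrow> real"
  dem_p :: "'n \<Rightarrow> real"
  dem_q :: "'n \<Rightarrow> real"
  tap :: "'e \<Rightarrow> real"
  s_max :: "'e \<Rightarrow> real"
  theta_max :: real
  v_lo :: "'n \<Rightarrow> real"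
  v_hi :: "'n \<Rightarrow> real"
  gp_lo :: "'g \<Rightarrow> real"
  gp_hi :: "'g \<Rightarrow> real"
  gq_lo :: "'g \<Rightarrow> real"
  gq_hi :: "'g \<Rightarrow> real"
  ramp :: "'g \<Rightarrow> real"
  adm :: "'d \<Rightarrow> real"                \<comment> \<open>\<open>a\<^sub>e\<close>\<close>
  ground :: "'m \<Rightarrow> real"             \<comment> \<open>\<open>a\<^sub>m\<close>\<close>
  loss_factor :: "'e \<Rightarrow> real"
  disp_E :: "'d \<Rightarrow> real"
  disp_N :: "'d \<Rightarrow> real"

definition wf_network :: "('n, 'm, 'e, 'd, 'g) network \<Rightarrow> bool" where
  "wf_network N \<longleftrightarrow>
     finite (ac_nodes N) \<and> finite (dc_nodes N) \<and> finite (ac_edges N) \<and>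
     finite (dc_edges N) \<and> finite (gens N) \<and>
     (\<forall>e\<in>ac_edges N. src N e \<in> ac_nodes N \<and> dst N e \<in> ac_nodes N \<and> src N e \<noteq> dst N e) \<and>
     (\<forall>e\<in>dc_edges N. dsrc N e \<in> dc_nodes N \<and> ddst N e \<in> dc_nodes N \<and> dsrc N e \<noteq> ddst N e) \<and>
     (\<forall>e\<in>dc_edges N. ac_line N e \<in> ac_edges N) \<and>
     (\<forall>k\<in>gens N. gen_bus N k \<in> ac_nodes N) \<and>
     trafos N \<subseteq> ac_edges N \<and>
     (\<forall>i\<in>ac_nodes N. trafos_at N i \<subseteq> trafos N) \<and>
     (\<forall>e\<in>trafos N. set_transformer (trafo_type N e) \<subseteq> dc_edges N) \<and>
     (\<forall>e\<in>trafos N. \<forall>\<alpha> h l. trafo_type N e \<in> {Auto \<alpha> h l, Gwye_Gwye \<alpha> h l} \<longrightarrow> 0 < \<alpha>) \<and>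
     (\<forall>k\<in>gens N. 0 \<le> cost0 N k \<and> 0 \<le> cost1 N k \<and> 0 \<le> cost2 N k \<and>
        0 \<le> costR1 N k \<and> 0 \<le> costR2 N k) \<and>
     (\<forall>i\<in>ac_nodes N. 0 \<le> shed_cost N i) \<and>
     (\<forall>e\<in>ac_edges N. 0 < tap N e) \<and>
     0 < theta_max N \<and> theta_max N < pi / 2 \<and>
     (\<forall>i\<in>ac_nodes N. 0 < v_lo N i \<and> v_lo N i \<le> v_hi N i) \<and>
     (\<forall>k\<in>gens N. gp_lo N k \<le> gp_hi N k \<and> gq_lo N k \<le> gq_hi N k)"

definition I_cap :: "('n, 'm, 'e, 'd, 'g) network \<Rightarrow> 'e \<Rightarrow> real" where
  "I_cap N e = s_max N e / min (v_lo N (src N e)) (v_lo N (dst N e))"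

definition I_max :: "('n, 'm, 'e, 'd, 'g) network \<Rightarrow> real" where
  "I_max N = Max ((\<lambda>e. 2 * I_cap N e) ` ac_edges N)"

definition S_eff :: "('n, 'm, 'e, 'd, 'g) network \<Rightarrow> ('d \<Rightarrow> real) \<Rightarrow> 'e \<Rightarrow> real" where
  "S_eff N I e =
     (case trafo_type N e of
        Step_Up h \<Rightarrow> I h
      | Auto \<alpha> s c \<Rightarrow> ((\<alpha> - 1) * I s + I c) / \<alpha>
      | Gwye_Gwye \<alpha> h l \<Rightarrow> (\<alpha> * I h + I l) / \<alpha>
      | Ungrounded \<Rightarrow> 0)"

text \<open>The random vector is \<open>\<omega> = [\<nu>\<^sup>E, \<nu>\<^sup>N]\<close>: component 1 is eastward, component 2 northward.\<close>

definition induced :: "('n, 'm, 'e, 'd, 'g) network \<Rightarrow> real ^ 2 \<Rightarrow> 'd \<Rightarrow> real" where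
  "induced N \<omega> e = \<omega> $ 2 * disp_N N e + \<omega> $ 1 * disp_E N e"


section \<open>The nonlinear two-stage problem\<close>

definition first_stage ::
    "('n, 'm, 'e, 'd, 'g) network \<Rightarrow> ('e \<Rightarrow> real) \<Rightarrow> ('g \<Rightarrow> real) \<Rightarrow> ('g \<Rightarrow> real) \<Rightarrow> bool" where
  "first_stage N za zg \<rho> \<longleftrightarrow>
     (\<forall>e\<in>ac_edges N. za e \<in> {0, 1}) \<and> (\<forall>i\<in>gens N. zg i \<in> {0, 1}) \<and>
     (\<forall>i\<in>gens N. zg i * gp_lo N i \<le> \<rho> i \<and> \<rho> i \<le> zg i * gp_hi N i)"

text \<open>Fields ending in \<open>f\<close> / \<open>t\<close> are flows measured at the source / destination of an AC edge.\<close>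

record ('n, 'm, 'e, 'd, 'g) decision =
  ds_Delta :: "'g \<Rightarrow> real"
  ds_fp :: "'g \<Rightarrow> real"
  ds_fq :: "'g \<Rightarrow> real"
  ds_pf :: "'e \<Rightarrow> real"
  ds_qf :: "'e \<Rightarrow> real"
  ds_pt :: "'e \<Rightarrow> real"
  ds_qt :: "'e \<Rightarrow> real"
  ds_v :: "'n \<Rightarrow> real"
  ds_theta :: "'n \<Rightarrow> real"
  ds_lp_plus :: "'n \<Rightarrow> real"
  ds_lp_minus :: "'n \<Rightarrow> real"
  ds_lq_plus :: "'n \<Rightarrow> real"
  ds_lq_minus :: "'n \<Rightarrow> real"
  ds_vd :: "'m \<Rightarrow> real"
  ds_Id :: "'d \<Rightarrow> real"
  ds_It :: "'e \<Rightarrow> real"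
  ds_qloss :: "'n \<Rightarrow> real"

definition second_cost ::
    "('n, 'm, 'e, 'd, 'g) network \<Rightarrow> ('n, 'm, 'e, 'd, 'g) decision \<Rightarrow> real" where
  "second_cost N s =
     (\<Sum>i\<in>gens N. costR2 N i * (ds_Delta s i)\<^sup>2 + costR1 N i * ds_Delta s i) +
     (\<Sum>i\<in>ac_nodes N. shed_cost N i *
        (ds_lp_plus s i + ds_lq_plus s i + ds_lp_minus s i + ds_lq_minus s i))"

definition gen_constraints ::
    "('n, 'm, 'e, 'd, 'g) network \<Rightarrow> ('g \<Rightarrow> real) \<Rightarrow> ('g \<Rightarrow> real) \<Rightarrow>
     ('n, 'm, 'e, 'd, 'g) decision \<Rightarrow> bool" where
  "gen_constraints N zg \<rho> s \<longleftrightarrow> (\<forall>i\<in>gens N.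
     0 \<le> ds_Delta s i \<and> ds_fp s i - \<rho> i \<le> ds_Delta s i \<and>
     zg i * gp_lo N i \<le> ds_fp s i \<and> ds_fp s i \<le> zg i * gp_hi N i \<and>
     zg i * gq_lo N i \<le> ds_fq s i \<and> ds_fq s i \<le> zg i * gq_hi N i \<and>
     \<bar>ds_fp s i - \<rho> i\<bar> \<le> zg i * ramp N i * gp_hi N i)"

definition node_constraints ::
    "('n, 'm, 'e, 'd, 'g) network \<Rightarrow> ('n, 'm, 'e, 'd, 'g) decision \<Rightarrow> bool" where
  "node_constraints N s \<longleftrightarrow> (\<forall>i\<in>ac_nodes N.
     v_lo N i \<le> ds_v s i \<and> ds_v s i \<le> v_hi N i \<and>
     0 \<le> ds_lp_plus s i \<and> 0 \<le> ds_lp_minus s i \<and> 0 \<le> ds_lq_plus s i \<and> 0 \<le> ds_lq_minus s i \<and>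
     (\<Sum>e | e \<in> ac_edges N \<and> src N e = i. ds_pf s e) +
       (\<Sum>e | e \<in> ac_edges N \<and> dst N e = i. ds_pt s e) =
       (\<Sum>k | k \<in> gens N \<and> gen_bus N k = i. ds_fp s k) - dem_p N i
         + ds_lp_plus s i - ds_lp_minus s i - (ds_v s i)\<^sup>2 * shunt_g N i \<and>
     (\<Sum>e | e \<in> ac_edges N \<and> src N e = i. ds_qf s e) +
       (\<Sum>e | e \<in> ac_edges N \<and> dst N e = i. ds_qt s e) =
       (\<Sum>k | k \<in> gens N \<and> gen_bus N k = i. ds_fq s k) - dem_q N i - ds_qloss s i
         + ds_lq_plus s i - ds_lq_minus s i + (ds_v s i)\<^sup>2 * shunt_b N i)"

definition flow_constraints ::
    "('n, 'm, 'e, 'd, 'g) network \<Rightarrow> ('e \<Rightarrow> real) \<Rightarrow> ('n, 'm, 'e, 'd, 'g) decision \<Rightarrow> bool" where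
  "flow_constraints N za s \<longleftrightarrow> (\<forall>e\<in>ac_edges N.
     let vi = ds_v s (src N e); vj = ds_v s (dst N e);
         \<theta> = ds_theta s (src N e) - ds_theta s (dst N e);
         g = cond N e; b = susc N e; bc = charge N e; \<alpha> = tap N e
     in ds_pf s e = za e * (1 / \<alpha>\<^sup>2 * g * vi\<^sup>2 - 1 / \<alpha> * vi * vj * (g * cos \<theta> + b * sin \<theta>)) \<and>
        ds_qf s e = za e * (- (1 / \<alpha>\<^sup>2) * (b + bc / 2) * vi\<^sup>2
                             + 1 / \<alpha> * vi * vj * (b * cos \<theta> - g * sin \<theta>)) \<and>
        ds_pt s e = za e * (g * vj\<^sup>2 - 1 / \<alpha> * vi * vj * (g * cos \<theta> - b * sin \<theta>)) \<and>
        ds_qt s e = za e * (- (b + bc / 2) * vj\<^sup>2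
                             + 1 / \<alpha> * vi * vj * (b * cos \<theta> + g * sin \<theta>)) \<and>
        za e * \<bar>\<theta>\<bar> \<le> theta_max N \<and>
        (ds_pf s e)\<^sup>2 + (ds_qf s e)\<^sup>2 \<le> za e * (s_max N e)\<^sup>2 \<and>
        (ds_pt s e)\<^sup>2 + (ds_qt s e)\<^sup>2 \<le> za e * (s_max N e)\<^sup>2)"

text \<open>
  The current on a DC edge is positive from \<open>dsrc\<close> to \<open>ddst\<close>, so by Kirchhoff's law the net
  inflow into a node equals the current to ground.
\<close>

definition net_inflow :: "('n, 'm, 'e, 'd, 'g) network \<Rightarrow> ('d \<Rightarrow> real) \<Rightarrow> 'm \<Rightarrow> real" where
  "net_inflow N I m =
     (\<Sum>e | e \<in> dc_edges N \<and> ddst N e = m. I e) - (\<Sum>e | e \<in> dc_edges N \<and> dsrc N e = m. I e)"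

definition gic_constraints ::
    "('n, 'm, 'e, 'd, 'g) network \<Rightarrow> ('e \<Rightarrow> real) \<Rightarrow> real ^ 2 \<Rightarrow>
     ('n, 'm, 'e, 'd, 'g) decision \<Rightarrow> bool" where
  "gic_constraints N za \<omega> s \<longleftrightarrow>
     (\<forall>m\<in>dc_nodes N. net_inflow N (ds_Id s) m = ground N m * ds_vd s m) \<and>
     (\<forall>e\<in>dc_edges N. ds_Id s e =
        za (ac_line N e) * adm N e * (ds_vd s (dsrc N e) - ds_vd s (ddst N e) + induced N \<omega> e)) \<and>
     (\<forall>e\<in>trafos N. S_eff N (ds_Id s) e \<le> ds_It s e \<and> - S_eff N (ds_Id s) e \<le> ds_It s e \<and>
        0 \<le> ds_It s e \<and> ds_It s e \<le> I_max N) \<and>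
     (\<forall>i\<in>ac_nodes N. ds_qloss s i = (\<Sum>e\<in>trafos_at N i. loss_factor N e * ds_v s i * ds_It s e))"

definition second_stage ::
    "('n, 'm, 'e, 'd, 'g) network \<Rightarrow> ('e \<Rightarrow> real) \<Rightarrow> ('g \<Rightarrow> real) \<Rightarrow> ('g \<Rightarrow> real) \<Rightarrow> real ^ 2 \<Rightarrow>
     ('n, 'm, 'e, 'd, 'g) decision set" where
  "second_stage N za zg \<rho> \<omega> =
     {s. gen_constraints N zg \<rho> s \<and> node_constraints N s \<and> flow_constraints N za s \<and>
         gic_constraints N za \<omega> s}"

definition H_o ::
    "('n, 'm, 'e, 'd, 'g) network \<Rightarrow> ('e \<Rightarrow> real) \<Rightarrow> ('g \<Rightarrow> real) \<Rightarrow> ('g \<Rightarrow> real) \<Rightarrow> real ^ 2 \<Rightarrow> ereal"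
  where
  "H_o N za zg \<rho> \<omega> = (INF s\<in>second_stage N za zg \<rho> \<omega>. ereal (second_cost N s))"

definition Omega :: "real \<Rightarrow> (real ^ 2) set" where
  "Omega \<nu> = {\<omega>. 0 \<le> \<omega> $ 2 \<and> \<omega> $ 2 \<le> \<nu> \<and> - \<nu> \<le> \<omega> $ 1 \<and> \<omega> $ 1 \<le> \<nu> \<and>
                 (\<omega> $ 2)\<^sup>2 + (\<omega> $ 1)\<^sup>2 \<le> \<nu>\<^sup>2}"

definition ambiguity :: "real \<Rightarrow> real ^ 2 \<Rightarrow> (real ^ 2) measure set" where
  "ambiguity \<nu> \<mu> =
     {P. prob_space P \<and> sets P = sets borel \<and> integrable P (\<lambda>\<omega>. \<omega>) \<and>
         integral\<^sup>L P (\<lambda>\<omega>. \<omega>) = \<mu> \<and> (AE \<omega> in P. \<omega> \<in> Omega \<nu>)}"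

definition ereal_expectation :: "'a measure \<Rightarrow> ('a \<Rightarrow> ereal) \<Rightarrow> ereal" where
  "ereal_expectation P f =
     enn2ereal (\<integral>\<^sup>+ \<omega>. e2ennreal (f \<omega>) \<partial>P) - enn2ereal (\<integral>\<^sup>+ \<omega>. e2ennreal (- f \<omega>) \<partial>P)"

definition Q_o :: "('n, 'm, 'e, 'd, 'g) network \<Rightarrow> real \<Rightarrow> real ^ 2 \<Rightarrow> ereal" where
  "Q_o N \<nu> \<mu> =
     (INF (za, zg, \<rho>) \<in> {(za, zg, \<rho>). first_stage N za zg \<rho>}.
        ereal (\<Sum>i\<in>gens N. zg i * cost0 N i + cost1 N i * \<rho> i + cost2 N i * (\<rho> i)\<^sup>2) +
        (SUP P\<in>ambiguity \<nu> \<mu>. ereal_expectation P (H_o N za zg \<rho>)))"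


section \<open>The linearized problem\<close>

text \<open>Sample points and variable bounds of the linearization.\<close>

record ('n, 'e, 'd, 'g) linearization =
  L_rho :: "'g \<Rightarrow> real set"
  L_Delta :: "'g \<Rightarrow> real set"
  L_v :: "'n \<Rightarrow> real set"
  L_w :: "'n \<Rightarrow> real set"
  L_wc :: "'e \<Rightarrow> real set"
  L_ws :: "'e \<Rightarrow> real set"
  L_p :: "'e \<Rightarrow> real set"
  L_q :: "'e \<Rightarrow> real set"
  wc_lo :: "'e \<Rightarrow> real"
  wc_hi :: "'e \<Rightarrow> real"
  ws_lo :: "'e \<Rightarrow> real"
  ws_hi :: "'e \<Rightarrow> real"
  dv_lo :: "'d \<Rightarrow> real"              \<comment> \<open>bounds on the DC voltage difference along an edge\<close>
  dv_hi :: "'d \<Rightarrow> real"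

definition uniformly_located :: "real \<Rightarrow> real \<Rightarrow> real set \<Rightarrow> bool" where
  "uniformly_located lo hi X \<longleftrightarrow>
     X \<subseteq> {lo..hi} \<and> (\<exists>a d (n::nat). X = (\<lambda>k. a + real k * d) ` {..<n})"

definition wf_sample_points ::
    "('n, 'm, 'e, 'd, 'g) network \<Rightarrow> ('n, 'e, 'd, 'g) linearization \<Rightarrow> bool" where
  "wf_sample_points N L \<longleftrightarrow>
     (\<forall>i\<in>gens N. uniformly_located (gp_lo N i) (gp_hi N i) (L_rho L i) \<and>
        uniformly_located 0 (ramp N i * gp_hi N i) (L_Delta L i)) \<and>
     (\<forall>i\<in>ac_nodes N. uniformly_located (v_lo N i) (v_hi N i) (L_v L i) \<and>
        uniformly_located ((v_lo N i)\<^sup>2) ((v_hi N i)\<^sup>2) (L_w L i)) \<and>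
     (\<forall>e\<in>ac_edges N. uniformly_located (wc_lo L e) (wc_hi L e) (L_wc L e) \<and>
        uniformly_located (ws_lo L e) (ws_hi L e) (L_ws L e) \<and>
        uniformly_located (- \<bar>s_max N e\<bar>) \<bar>s_max N e\<bar> (L_p L e) \<and>
        uniformly_located (- \<bar>s_max N e\<bar>) \<bar>s_max N e\<bar> (L_q L e))"

definition voltage_angle_range ::
    "('n, 'm, 'e, 'd, 'g) network \<Rightarrow> 'e \<Rightarrow> (real \<times> real \<times> real) set" where
  "voltage_angle_range N e =
     {v_lo N (src N e)..v_hi N (src N e)} \<times> {v_lo N (dst N e)..v_hi N (dst N e)} \<times>
     {- theta_max N..theta_max N}"

definition valid_w_bounds ::
    "('n, 'm, 'e, 'd, 'g) network \<Rightarrow> ('n, 'e, 'd, 'g) linearization \<Rightarrow> bool" where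
  "valid_w_bounds N L \<longleftrightarrow>
     (\<forall>e\<in>ac_edges N. \<forall>(vi, vj, \<theta>)\<in>voltage_angle_range N e.
        vi * vj * cos \<theta> \<in> {wc_lo L e..wc_hi L e} \<and> vi * vj * sin \<theta> \<in> {ws_lo L e..ws_hi L e})"

text \<open>
  For sample points off the surface \<open>(\<ell>\<^sup>c)\<^sup>2 + (\<ell>\<^sup>s)\<^sup>2 = \<ell>\<^sup>f \<ell>\<^sup>t\<close> the linear constraint replacing the
  rotated second-order cone need not be implied by it: on the surface
  \<open>(w\<^sup>c)\<^sup>2 + (w\<^sup>s)\<^sup>2 = w\<^sub>i w\<^sub>j\<close> it reads
  \<open>(w\<^sub>i - \<ell>\<^sup>f) (w\<^sub>j - \<ell>\<^sup>t) \<le> (w\<^sup>c - \<ell>\<^sup>c)\<^sup>2 + (w\<^sup>s - \<ell>\<^sup>s)\<^sup>2\<close>.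
  The following condition says that no cut removes an operating point within the voltage and
  angle limits.
\<close>

definition valid_cone_cuts ::
    "('n, 'm, 'e, 'd, 'g) network \<Rightarrow> ('n, 'e, 'd, 'g) linearization \<Rightarrow> bool" where
  "valid_cone_cuts N L \<longleftrightarrow>
     (\<forall>e\<in>ac_edges N. \<forall>lc\<in>L_wc L e. \<forall>ls\<in>L_ws L e.
        \<forall>lf\<in>L_w L (src N e). \<forall>lt\<in>L_w L (dst N e). \<forall>(vi, vj, \<theta>)\<in>voltage_angle_range N e.
          2 * (vi * vj * cos \<theta> * lc + vi * vj * sin \<theta> * ls) - vi\<^sup>2 * lt - vj\<^sup>2 * lf
            \<le> lc\<^sup>2 + ls\<^sup>2 - lf * lt)"

definition valid_dv_bounds ::
    "('n, 'm, 'e, 'd, 'g) network \<Rightarrow> ('n, 'e, 'd, 'g) linearization \<Rightarrow> real \<Rightarrow> bool" where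
  "valid_dv_bounds N L \<nu> \<longleftrightarrow>
     (\<forall>za zg \<rho>. first_stage N za zg \<rho> \<longrightarrow> (\<forall>\<omega>\<in>Omega \<nu>.
        (INF s\<in>{s \<in> second_stage N za zg \<rho> \<omega>. \<forall>e\<in>dc_edges N.
                  ds_vd s (dsrc N e) - ds_vd s (ddst N e) \<in> {dv_lo L e..dv_hi L e}}.
           ereal (second_cost N s)) = H_o N za zg \<rho> \<omega>))"

text \<open>
  \<open>mc_slacks\<close> lists the slacks of the McCormick inequalities for \<open>c \<approx> a b\<close>, followed by those
  of the bounds on \<open>a\<close> and \<open>b\<close>.
\<close>

definition mc_slacks ::
    "real \<Rightarrow> real \<Rightarrow> real \<Rightarrow> real \<Rightarrow> real \<Rightarrow> real \<Rightarrow> real \<Rightarrow> real list" where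
  "mc_slacks al au bl bu a b c =
     [c - (al * b + bl * a - al * bl),
      c - (au * b + bu * a - au * bu),
      al * b + bu * a - al * bu - c,
      au * b + bl * a - au * bl - c,
      a - al, au - a, b - bl, bu - b]"

definition mccormick ::
    "real \<Rightarrow> real \<Rightarrow> real \<Rightarrow> real \<Rightarrow> real \<Rightarrow> real \<Rightarrow> real set" where
  "mccormick al au bl bu a b = {c. \<forall>t\<in>set (mc_slacks al au bl bu a b c). 0 \<le> t}"

datatype ('e, 'g) yvar = Za 'e | Zg 'g | Rho 'g | RhoSq 'g

datatype ('n, 'm, 'e, 'd, 'g) xvar =
    Delta 'g | DeltaSq 'g | Fp 'g | Fq 'g
  | LpPlus 'n | LpMinus 'n | LqPlus 'n | LqMinus 'n
  | Vm 'n | Vsq 'n | WzF 'e | WzT 'e | Wc 'e | Ws 'e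
  | Pf 'e | Qf 'e | Pt 'e | Qt 'e
  | Vd 'm | Vzd 'd | Id_cur 'd | It 'e | Ud 'n 'e | Qloss 'n

text \<open>A row is the slack of a linear constraint, as a function of \<open>y\<close> and of the unsplit \<open>x\<close>.\<close>

type_synonym ('n, 'm, 'e, 'd, 'g) row =
  "(('e, 'g) yvar \<Rightarrow> real) \<Rightarrow> (('n, 'm, 'e, 'd, 'g) xvar \<Rightarrow> real) \<Rightarrow> real"

definition eq_rows :: "('n, 'm, 'e, 'd, 'g) row \<Rightarrow> ('n, 'm, 'e, 'd, 'g) row set" where
  "eq_rows r = {r, \<lambda>y x. - r y x}"

definition mc_rows ::
    "real \<Rightarrow> real \<Rightarrow> real \<Rightarrow> real \<Rightarrow> ('n, 'm, 'e, 'd, 'g) row \<Rightarrow> ('n, 'm, 'e, 'd, 'g) row \<Rightarrow>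
     ('n, 'm, 'e, 'd, 'g) row \<Rightarrow> ('n, 'm, 'e, 'd, 'g) row set" where
  "mc_rows al au bl bu a b c =
     (\<lambda>k y x. mc_slacks al au bl bu (a y x) (b y x) (c y x) ! k) ` {..<8}"

definition gen_rows ::
    "('n, 'm, 'e, 'd, 'g) network \<Rightarrow> ('n, 'e, 'd, 'g) linearization \<Rightarrow> 'g \<Rightarrow>
     ('n, 'm, 'e, 'd, 'g) row set" where
  "gen_rows N L i =
     {\<lambda>y x. x (Delta i) - (x (Fp i) - y (Rho i)),
      \<lambda>y x. x (Fp i) - y (Zg i) * gp_lo N i, \<lambda>y x. y (Zg i) * gp_hi N i - x (Fp i),
      \<lambda>y x. x (Fq i) - y (Zg i) * gq_lo N i, \<lambda>y x. y (Zg i) * gq_hi N i - x (Fq i),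
      \<lambda>y x. y (Zg i) * ramp N i * gp_hi N i - (x (Fp i) - y (Rho i)),
      \<lambda>y x. y (Zg i) * ramp N i * gp_hi N i + (x (Fp i) - y (Rho i))}
     \<union> (\<lambda>l y x. x (DeltaSq i) - (2 * l * x (Delta i) - y (Zg i) * l\<^sup>2)) ` L_Delta L i"

definition node_rows ::
    "('n, 'm, 'e, 'd, 'g) network \<Rightarrow> ('n, 'e, 'd, 'g) linearization \<Rightarrow> 'n \<Rightarrow>
     ('n, 'm, 'e, 'd, 'g) row set" where
  "node_rows N L i =
     {\<lambda>y x. x (Vm i) - v_lo N i, \<lambda>y x. v_hi N i - x (Vm i),
      \<lambda>y x. (v_hi N i + v_lo N i) * x (Vm i) - v_hi N i * v_lo N i - x (Vsq i)}
     \<union> (\<lambda>l y x. x (Vsq i) - (2 * l * x (Vm i) - l\<^sup>2)) ` L_v L i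
     \<union> eq_rows (\<lambda>y x.
          (\<Sum>e | e \<in> ac_edges N \<and> src N e = i. x (Pf e)) +
          (\<Sum>e | e \<in> ac_edges N \<and> dst N e = i. x (Pt e)) -
          ((\<Sum>k | k \<in> gens N \<and> gen_bus N k = i. x (Fp k)) - dem_p N i
             + x (LpPlus i) - x (LpMinus i) - x (Vsq i) * shunt_g N i))
     \<union> eq_rows (\<lambda>y x.
          (\<Sum>e | e \<in> ac_edges N \<and> src N e = i. x (Qf e)) +
          (\<Sum>e | e \<in> ac_edges N \<and> dst N e = i. x (Qt e)) -
          ((\<Sum>k | k \<in> gens N \<and> gen_bus N k = i. x (Fq k)) - dem_q N i - x (Qloss i)
             + x (LqPlus i) - x (LqMinus i) + x (Vsq i) * shunt_b N i))
     \<union> eq_rows (\<lambda>y x. x (Qloss i) - (\<Sum>e\<in>trafos_at N i. loss_factor N e * x (Ud i e)))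
     \<union> (\<Union>e\<in>trafos_at N i. mc_rows (v_lo N i) (v_hi N i) 0 (I_max N)
          (\<lambda>y x. x (Vm i)) (\<lambda>y x. x (It e)) (\<lambda>y x. x (Ud i e)))"

definition flow_rows ::
    "('n, 'm, 'e, 'd, 'g) network \<Rightarrow> 'e \<Rightarrow> ('n, 'm, 'e, 'd, 'g) row set" where
  "flow_rows N e =
     (let g = cond N e; b = susc N e; bc = charge N e; \<alpha> = tap N e in
       eq_rows (\<lambda>y x. x (Pf e) -
         (1 / \<alpha>\<^sup>2 * g * x (WzF e) - 1 / \<alpha> * (g * x (Wc e) + b * x (Ws e))))
     \<union> eq_rows (\<lambda>y x. x (Qf e) -
         (- (1 / \<alpha>\<^sup>2) * (b + bc / 2) * x (WzF e) + 1 / \<alpha> * (b * x (Wc e) - g * x (Ws e))))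
     \<union> eq_rows (\<lambda>y x. x (Pt e) -
         (g * x (WzT e) - 1 / \<alpha> * (g * x (Wc e) - b * x (Ws e))))
     \<union> eq_rows (\<lambda>y x. x (Qt e) -
         (- (b + bc / 2) * x (WzT e) + 1 / \<alpha> * (b * x (Wc e) + g * x (Ws e)))))"

definition edge_rows ::
    "('n, 'm, 'e, 'd, 'g) network \<Rightarrow> ('n, 'e, 'd, 'g) linearization \<Rightarrow> 'e \<Rightarrow>
     ('n, 'm, 'e, 'd, 'g) row set" where
  "edge_rows N L e =
     flow_rows N e
     \<union> mc_rows 0 1 ((v_lo N (src N e))\<^sup>2) ((v_hi N (src N e))\<^sup>2)
         (\<lambda>y x. y (Za e)) (\<lambda>y x. x (Vsq (src N e))) (\<lambda>y x. x (WzF e))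
     \<union> mc_rows 0 1 ((v_lo N (dst N e))\<^sup>2) ((v_hi N (dst N e))\<^sup>2)
         (\<lambda>y x. y (Za e)) (\<lambda>y x. x (Vsq (dst N e))) (\<lambda>y x. x (WzT e))
     \<union> {\<lambda>y x. x (Wc e) - y (Za e) * wc_lo L e, \<lambda>y x. y (Za e) * wc_hi L e - x (Wc e),
        \<lambda>y x. x (Ws e) - y (Za e) * ws_lo L e, \<lambda>y x. y (Za e) * ws_hi L e - x (Ws e),
        \<lambda>y x. x (Ws e) + tan (theta_max N) * x (Wc e),
        \<lambda>y x. tan (theta_max N) * x (Wc e) - x (Ws e)}
     \<union> (\<lambda>(lc, ls, lf, lt) y x.
          y (Za e) * (lc\<^sup>2 + ls\<^sup>2 - lf * lt)
            - (2 * (x (Wc e) * lc + x (Ws e) * ls) - x (WzF e) * lt - x (WzT e) * lf))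
        ` (L_wc L e \<times> L_ws L e \<times> L_w L (src N e) \<times> L_w L (dst N e))
     \<union> (\<lambda>(lp, lq) y x.
          y (Za e) * ((s_max N e)\<^sup>2 + lp\<^sup>2 + lq\<^sup>2) - (2 * x (Pf e) * lp + 2 * x (Qf e) * lq))
        ` (L_p L e \<times> L_q L e)
     \<union> (\<lambda>(lp, lq) y x.
          y (Za e) * ((s_max N e)\<^sup>2 + lp\<^sup>2 + lq\<^sup>2) - (2 * x (Pt e) * lp + 2 * x (Qt e) * lq))
        ` (L_p L e \<times> L_q L e)"

definition gic_rows ::
    "('n, 'm, 'e, 'd, 'g) network \<Rightarrow> ('n, 'e, 'd, 'g) linearization \<Rightarrow>
     ('n, 'm, 'e, 'd, 'g) row set" where
  "gic_rows N L =
     (\<Union>m\<in>dc_nodes N. eq_rows (\<lambda>y x.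
        net_inflow N (\<lambda>e. x (Id_cur e)) m - ground N m * x (Vd m)))
     \<union> (\<Union>e\<in>trafos N.
         {\<lambda>y x. x (It e) - S_eff N (\<lambda>d. x (Id_cur d)) e,
          \<lambda>y x. x (It e) + S_eff N (\<lambda>d. x (Id_cur d)) e,
          \<lambda>y x. I_max N - x (It e)})
     \<union> (\<Union>e\<in>dc_edges N. mc_rows 0 1 (dv_lo L e) (dv_hi L e)
          (\<lambda>y x. y (Za (ac_line N e))) (\<lambda>y x. x (Vd (dsrc N e)) - x (Vd (ddst N e)))
          (\<lambda>y x. x (Vzd e)))"

text \<open>All second-stage constraints except sign constraints and the equations containing \<open>\<omega>\<close>.\<close>

definition rows ::
    "('n, 'm, 'e, 'd, 'g) network \<Rightarrow> ('n, 'e, 'd, 'g) linearization \<Rightarrow>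
     ('n, 'm, 'e, 'd, 'g) row set" where
  "rows N L =
     (\<Union>i\<in>gens N. gen_rows N L i) \<union> (\<Union>i\<in>ac_nodes N. node_rows N L i) \<union>
     (\<Union>e\<in>ac_edges N. edge_rows N L e) \<union> gic_rows N L"


section \<open>Standard form\<close>

definition yvars :: "('n, 'm, 'e, 'd, 'g) network \<Rightarrow> ('e, 'g) yvar set" where
  "yvars N = Za ` ac_edges N \<union> Zg ` gens N \<union> Rho ` gens N \<union> RhoSq ` gens N"

definition nonneg_vars :: "('n, 'm, 'e, 'd, 'g) network \<Rightarrow> ('n, 'm, 'e, 'd, 'g) xvar set" where
  "nonneg_vars N = Delta ` gens N \<union> LpPlus ` ac_nodes N \<union> LpMinus ` ac_nodes N \<union>
     LqPlus ` ac_nodes N \<union> LqMinus ` ac_nodes N \<union> It ` trafos N"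

definition free_vars :: "('n, 'm, 'e, 'd, 'g) network \<Rightarrow> ('n, 'm, 'e, 'd, 'g) xvar set" where
  "free_vars N = DeltaSq ` gens N \<union> Fp ` gens N \<union> Fq ` gens N \<union>
     Vm ` ac_nodes N \<union> Vsq ` ac_nodes N \<union> Qloss ` ac_nodes N \<union>
     WzF ` ac_edges N \<union> WzT ` ac_edges N \<union> Wc ` ac_edges N \<union> Ws ` ac_edges N \<union>
     Pf ` ac_edges N \<union> Qf ` ac_edges N \<union> Pt ` ac_edges N \<union> Qt ` ac_edges N \<union>
     Vd ` dc_nodes N \<union> Vzd ` dc_edges N \<union> Id_cur ` dc_edges N \<union>
     (\<Union>i\<in>ac_nodes N. Ud i ` trafos_at N i)"

text \<open>A sign-free variable \<open>v\<close> is split as \<open>Pos v - Neg v\<close>.\<close>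

datatype 'v col = Pos 'v | Neg 'v

definition cols :: "('n, 'm, 'e, 'd, 'g) network \<Rightarrow> ('n, 'm, 'e, 'd, 'g) xvar col set" where
  "cols N = Pos ` (nonneg_vars N \<union> free_vars N) \<union> Neg ` free_vars N"

fun split_coeff :: "('v \<Rightarrow> real) \<Rightarrow> 'v col \<Rightarrow> real" where
  "split_coeff f (Pos v) = f v"
| "split_coeff f (Neg v) = - f v"

definition unit_at :: "'v \<Rightarrow> 'v \<Rightarrow> real" where
  "unit_at v = (\<lambda>u. if u = v then 1 else 0)"

text \<open>
  Every row is affine, so its coefficients are obtained by evaluation at the origin and at unit
  vectors.
\<close>

definition h_vec :: "('n, 'm, 'e, 'd, 'g) row \<Rightarrow> real" where
  "h_vec r = - r (\<lambda>_. 0) (\<lambda>_. 0)"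

definition G_mat :: "('n, 'm, 'e, 'd, 'g) row \<Rightarrow> ('e, 'g) yvar \<Rightarrow> real" where
  "G_mat r k = r (unit_at k) (\<lambda>_. 0) - r (\<lambda>_. 0) (\<lambda>_. 0)"

definition E_mat :: "('n, 'm, 'e, 'd, 'g) row \<Rightarrow> ('n, 'm, 'e, 'd, 'g) xvar col \<Rightarrow> real" where
  "E_mat r = split_coeff (\<lambda>v. r (\<lambda>_. 0) (unit_at v) - r (\<lambda>_. 0) (\<lambda>_. 0))"

text \<open>
  Row \<open>e\<close> of \<open>T(\<omega>) y = W x\<close> is
  \<open>z\<^sup>a a\<^sub>e (\<omega>\<^sub>1 L\<^sup>E\<^sub>e + \<omega>\<^sub>2 L\<^sup>N\<^sub>e) = I\<^sup>d\<^sub>e - a\<^sub>e v\<^sup>z\<^sup>d\<^sub>e\<close>.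
\<close>

definition T_mat :: "('n, 'm, 'e, 'd, 'g) network \<Rightarrow> 2 \<Rightarrow> 'd \<Rightarrow> ('e, 'g) yvar \<Rightarrow> real" where
  "T_mat N i e k =
     (if k = Za (ac_line N e) then adm N e * (if i = 1 then disp_E N e else disp_N N e) else 0)"

definition W_mat ::
    "('n, 'm, 'e, 'd, 'g) network \<Rightarrow> 'd \<Rightarrow> ('n, 'm, 'e, 'd, 'g) xvar col \<Rightarrow> real" where
  "W_mat N e = split_coeff (\<lambda>v. unit_at (Id_cur e) v - adm N e * unit_at (Vzd e) v)"

definition c_vec :: "('n, 'm, 'e, 'd, 'g) network \<Rightarrow> ('n, 'm, 'e, 'd, 'g) xvar col \<Rightarrow> real" where
  "c_vec N = split_coeff (\<lambda>v. case v of
       DeltaSq i \<Rightarrow> costR2 N i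
     | Delta i \<Rightarrow> costR1 N i
     | LpPlus i \<Rightarrow> shed_cost N i
     | LpMinus i \<Rightarrow> shed_cost N i
     | LqPlus i \<Rightarrow> shed_cost N i
     | LqMinus i \<Rightarrow> shed_cost N i
     | _ \<Rightarrow> 0)"

definition y_feasible ::
    "('n, 'm, 'e, 'd, 'g) network \<Rightarrow> ('n, 'e, 'd, 'g) linearization \<Rightarrow>
     (('e, 'g) yvar \<Rightarrow> real) \<Rightarrow> bool" where
  "y_feasible N L y \<longleftrightarrow>
     first_stage N (\<lambda>e. y (Za e)) (\<lambda>i. y (Zg i)) (\<lambda>i. y (Rho i)) \<and>
     (\<forall>i\<in>gens N. \<forall>l\<in>L_rho L i. y (RhoSq i) \<ge> 2 * y (Rho i) * l - y (Zg i) * l\<^sup>2)"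

definition y_cost :: "('n, 'm, 'e, 'd, 'g) network \<Rightarrow> (('e, 'g) yvar \<Rightarrow> real) \<Rightarrow> real" where
  "y_cost N y =
     (\<Sum>i\<in>gens N. y (Zg i) * cost0 N i + cost1 N i * y (Rho i) + cost2 N i * y (RhoSq i))"

definition lin_second_stage ::
    "('n, 'm, 'e, 'd, 'g) network \<Rightarrow> ('n, 'e, 'd, 'g) linearization \<Rightarrow>
     (('e, 'g) yvar \<Rightarrow> real) \<Rightarrow> real ^ 2 \<Rightarrow> (('n, 'm, 'e, 'd, 'g) xvar col \<Rightarrow> real) set" where
  "lin_second_stage N L y \<omega> =
     {x. (\<forall>c\<in>cols N. 0 \<le> x c) \<and>
         (\<forall>r\<in>rows N L. (\<Sum>k\<in>yvars N. G_mat r k * y k) + (\<Sum>c\<in>cols N. E_mat r c * x c) \<ge> h_vec r) \<and>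
         (\<forall>e\<in>dc_edges N. (\<Sum>k\<in>yvars N. (\<Sum>i\<in>UNIV. T_mat N i e k * \<omega> $ i) * y k) =
                          (\<Sum>c\<in>cols N. W_mat N e c * x c))}"

definition dual_feasible ::
    "('n, 'm, 'e, 'd, 'g) network \<Rightarrow> ('n, 'e, 'd, 'g) linearization \<Rightarrow>
     (('n, 'm, 'e, 'd, 'g) row \<Rightarrow> real) \<Rightarrow> ('d \<Rightarrow> real) \<Rightarrow> bool" where
  "dual_feasible N L \<gamma> \<pi> \<longleftrightarrow>
     (\<forall>c\<in>cols N. (\<Sum>r\<in>rows N L. E_mat r c * \<gamma> r) + (\<Sum>e\<in>dc_edges N. W_mat N e c * \<pi> e)
                  \<le> c_vec N c) \<and>
     (\<forall>r\<in>rows N L. 0 \<le> \<gamma> r)"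


section \<open>The vertex formulation\<close>

definition vertices :: "(real ^ 2) set \<Rightarrow> (real ^ 2) set" where
  "vertices D = {\<omega>. \<omega> extreme_point_of D}"

text \<open>The vertices themselves serve as the index set for \<open>\<beta>\<close> and \<open>\<zeta>\<close>.\<close>

definition V_feasible ::
    "('n, 'm, 'e, 'd, 'g) network \<Rightarrow> ('n, 'e, 'd, 'g) linearization \<Rightarrow> (real ^ 2) set \<Rightarrow>
     ('d \<Rightarrow> real) \<Rightarrow> ('d \<Rightarrow> real) \<Rightarrow>
     (('n, 'm, 'e, 'd, 'g) row \<Rightarrow> real) \<Rightarrow> ('d \<Rightarrow> real) \<Rightarrow> real ^ 2 \<Rightarrow>
     (real ^ 2 \<Rightarrow> real) \<Rightarrow> (real ^ 2 \<Rightarrow> 'd \<Rightarrow> real) \<Rightarrow> bool" where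
  "V_feasible N L D \<pi>lo \<pi>hi \<gamma> \<pi> \<omega> \<beta> \<zeta> \<longleftrightarrow>
     dual_feasible N L \<gamma> \<pi> \<and>
     (\<forall>j\<in>vertices D. \<forall>e\<in>dc_edges N. \<zeta> j e \<in> mccormick 0 1 (\<pi>lo e) (\<pi>hi e) (\<beta> j) (\<pi> e)) \<and>
     \<omega> = (\<Sum>j\<in>vertices D. \<beta> j *\<^sub>R j) \<and> (\<Sum>j\<in>vertices D. \<beta> j) = 1 \<and>
     (\<forall>j\<in>vertices D. \<beta> j \<in> {0, 1})"

definition V_objective ::
    "('n, 'm, 'e, 'd, 'g) network \<Rightarrow> ('n, 'e, 'd, 'g) linearization \<Rightarrow> (real ^ 2) set \<Rightarrow>
     (('e, 'g) yvar \<Rightarrow> real) \<Rightarrow> real ^ 2 \<Rightarrow>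
     (('n, 'm, 'e, 'd, 'g) row \<Rightarrow> real) \<Rightarrow> real ^ 2 \<Rightarrow> (real ^ 2 \<Rightarrow> 'd \<Rightarrow> real) \<Rightarrow> real" where
  "V_objective N L D y lam \<gamma> \<omega> \<zeta> =
     (\<Sum>r\<in>rows N L. (h_vec r - (\<Sum>k\<in>yvars N. G_mat r k * y k)) * \<gamma> r) +
     (\<Sum>k\<in>yvars N. y k *
        (\<Sum>i\<in>UNIV. \<Sum>j\<in>vertices D. (\<Sum>e\<in>dc_edges N. T_mat N i e k * \<zeta> j e) * j $ i)) -
     lam \<bullet> \<omega>"

definition V_value ::
    "('n, 'm, 'e, 'd, 'g) network \<Rightarrow> ('n, 'e, 'd, 'g) linearization \<Rightarrow> (real ^ 2) set \<Rightarrow>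
     ('d \<Rightarrow> real) \<Rightarrow> ('d \<Rightarrow> real) \<Rightarrow> (('e, 'g) yvar \<Rightarrow> real) \<Rightarrow> real ^ 2 \<Rightarrow> ereal" where
  "V_value N L D \<pi>lo \<pi>hi y lam =
     Sup {ereal (V_objective N L D y lam \<gamma> \<omega> \<zeta>) | \<gamma> \<pi> \<omega> \<beta> \<zeta>.
            V_feasible N L D \<pi>lo \<pi>hi \<gamma> \<pi> \<omega> \<beta> \<zeta>}"

definition Q_v ::
    "('n, 'm, 'e, 'd, 'g) network \<Rightarrow> ('n, 'e, 'd, 'g) linearization \<Rightarrow> (real ^ 2) set \<Rightarrow>
     ('d \<Rightarrow> real) \<Rightarrow> ('d \<Rightarrow> real) \<Rightarrow> real ^ 2 \<Rightarrow> ereal" where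
  "Q_v N L D \<pi>lo \<pi>hi \<mu> =
     (INF (y, lam, \<eta>) \<in> {(y, lam, \<eta>). y_feasible N L y \<and> ereal \<eta> \<ge> V_value N L D \<pi>lo \<pi>hi y lam}.
        ereal (y_cost N y + \<mu> \<bullet> lam + \<eta>))"

end

theory Submission
  imports Defs
begin

text \<open>
  Fix a first-stage decision with its worst-case expectation \<open>S\<close>, taken over all distributions
  with mean \<open>\<mu>\<close>, and extend the decision to the linearized first stage by \<open>\<rho>\<^sup>2\<close>, which leaves its
  cost unchanged. It is enough to find, for every real \<open>T > S\<close>, a multiplier \<open>lam\<close> such that
  \<open>(y, lam, T - lam \<bullet> \<mu>)\<close> is feasible for the vertex formulation, since the value of this triple
  is the first-stage cost plus \<open>T\<close>. Three facts give such a multiplier.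

  The linearization is a relaxation. From an operating point of the nonlinear second stage one
  obtains a point of the linear one by giving every auxiliary variable the value of the product
  it stands for (\<open>lifted_point_feasible\<close>), at no larger cost (\<open>lifted_point_cost_le\<close>). By weak
  duality every dual point at a vertex \<open>j\<close> of the support is therefore worth at most \<open>H\<^sub>o(j)\<close>
  (\<open>dual_value_le_H_o\<close>), and so is the supremum \<open>h(j)\<close> of these values. It is a real number because
  the dual is feasible and so is the linear second stage at \<open>j\<close>.

  The inner maximization picks one vertex. Exactly one binary \<open>\<beta>\<^sub>j\<close> equals 1, and the McCormick
  sets are exact at binary arguments, so the objective is a dual value at \<open>j\<close> minus \<open>lam \<bullet> j\<close>
  (\<open>V_objective_at_vertex\<close>). Hence \<open>V(y, lam)\<close> is at most the maximum of \<open>h(j) - lam \<bullet> j\<close>.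

  The multiplier exists by separation. A convex combination of the vertices with mean \<open>\<mu>\<close> is a
  distribution in the ambiguity set, and its expectation of \<open>H\<^sub>o\<close> is at least \<open>\<Sum>\<^sub>j p\<^sub>j h(j)\<close>
  (\<open>discrete_distribution_expectation\<close>), so \<open>\<Sum>\<^sub>j p\<^sub>j h(j) \<le> S < T\<close> for all such combinations. Then
  some \<open>lam\<close> satisfies \<open>h(j) - lam \<bullet> j \<le> T - lam \<bullet> \<mu>\<close> at all vertices (\<open>finite_moment_duality\<close>).
  This covers the case that \<open>\<mu>\<close> is no convex combination of the vertices: every \<open>T\<close> then
  qualifies for the separation, however small.
\<close>

section \<open>Probability measures with prescribed mean on finitely many points\<close>

text \<open>
  By hypothesis \<open>(\<mu>, T)\<close> is outside the closed convex region consisting of the convex hull of the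
  graph of \<open>h\<close> on \<open>J\<close> and all points below it, so it can be strictly separated from this region. If the separating hyperplane is not vertical, its
  slope is the multiplier. It is vertical only if it separates \<open>\<mu>\<close> from \<open>J\<close> itself, and then a
  large multiple of its normal works for any \<open>T\<close>.
\<close>

lemma finite_moment_duality:
  fixes h :: "'a::euclidean_space \<Rightarrow> real"
  assumes fin: "finite J"
    and below: "\<And>p. (\<forall>j\<in>J. 0 \<le> p j) \<Longrightarrow> sum p J = 1 \<Longrightarrow> (\<Sum>j\<in>J. p j *\<^sub>R j) = \<mu> \<Longrightarrow>
                  (\<Sum>j\<in>J. p j * h j) < T"
  shows "\<exists>lam. \<forall>j\<in>J. h j - lam \<bullet> j \<le> T - lam \<bullet> \<mu>"
proof (cases "J = {}")
  case False
  then obtain j0 where j0: "j0 \<in> J" by blast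
  define S where "S = (\<lambda>j. (j, h j)) ` J"
  define D where "D = {0::'a} \<times> {..0::real}"
  define C where "C = (\<Union>x\<in>convex hull S. \<Union>y\<in>D. {x + y})"
  have S: "finite S" using fin by (simp add: S_def)
  have clC: "closed C"
    unfolding C_def D_def using S
    by (intro compact_closed_sums closed_Times)
       (auto simp: compact_convex_hull finite_imp_compact)
  have cvC: "convex C"
    unfolding C_def D_def by (intro convex_sums convex_Times) auto
  have notin: "(\<mu>, T) \<notin> C"
  proof
    assume "(\<mu>, T) \<in> C"
    then obtain t where t: "(\<mu>, t) \<in> convex hull S" "T \<le> t"
      by (auto simp: C_def D_def)
    from t(1) S obtain u where u: "\<forall>x\<in>S. 0 \<le> u x" "sum u S = 1" "(\<Sum>x\<in>S. u x *\<^sub>R x) = (\<mu>, t)"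
      by (auto simp: convex_hull_finite)
    define p where "p = (\<lambda>j. u (j, h j))"
    have inj: "inj_on (\<lambda>j. (j, h j)) J" by (auto simp: inj_on_def)
    have eq: "(\<Sum>j\<in>J. p j *\<^sub>R (j, h j)) = (\<mu>, t)"
      using u(3) by (simp add: S_def sum.reindex[OF inj] p_def)
    have "(\<Sum>j\<in>J. p j *\<^sub>R j) = \<mu>" "(\<Sum>j\<in>J. p j * h j) = t"
      using arg_cong[OF eq, of fst] arg_cong[OF eq, of snd] by (simp_all add: fst_sum snd_sum)
    moreover have "\<forall>j\<in>J. 0 \<le> p j" using u(1) by (simp add: S_def p_def)
    moreover have "sum p J = 1" using u(2) by (simp add: S_def sum.reindex[OF inj] p_def)
    ultimately show False using below[of p] t(2) by simp
  qed
  obtain a b where ab: "a \<bullet> (\<mu>, T) < b" "\<forall>x\<in>C. b < a \<bullet> x"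
    using separating_hyperplane_closed_point[OF cvC clC notin] by blast
  obtain a1 a2 where a: "a = (a1, a2)" by (cases a)
  have sep: "b < a1 \<bullet> j + a2 * (h j + s)" if "j \<in> J" "s \<le> 0" for j s
  proof -
    have "(j, h j) \<in> convex hull S" using that hull_inc[of "(j, h j)" S convex] by (auto simp: S_def)
    then have "(j, h j) + (0, s) \<in> C" using that(2) unfolding C_def D_def by blast
    then show ?thesis using ab(2) by (force simp: a)
  qed
  have base: "a1 \<bullet> \<mu> + a2 * T < b" using ab(1) by (simp add: a)
  \<comment> \<open>The region is unbounded downwards, which fixes the sign of the vertical component.\<close>
  have "a2 \<le> 0"
  proof (rule ccontr)
    assume "\<not> a2 \<le> 0"
    define s where "s = - \<bar>(a1 \<bullet> j0 + a2 * h j0 - b) / a2\<bar>"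
    have "a2 * s \<le> - (a1 \<bullet> j0 + a2 * h j0 - b)"
      using \<open>\<not> a2 \<le> 0\<close> by (simp add: s_def abs_mult)
    moreover have "b < a1 \<bullet> j0 + a2 * (h j0 + s)" by (rule sep[OF j0]) (simp add: s_def)
    ultimately show False by (simp add: algebra_simps)
  qed
  then consider "a2 < 0" | "a2 = 0" by linarith
  then show ?thesis
  proof cases
    case 1
    have "h j - (- (1 / a2)) *\<^sub>R a1 \<bullet> j \<le> T - (- (1 / a2)) *\<^sub>R a1 \<bullet> \<mu>" if "j \<in> J" for j
    proof -
      have "a1 \<bullet> \<mu> + a2 * T < a1 \<bullet> j + a2 * h j" using base sep[OF that, of 0] by simp
      then have "(- (1 / a2)) * (a1 \<bullet> \<mu> + a2 * T) \<le> (- (1 / a2)) * (a1 \<bullet> j + a2 * h j)"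
        using 1 by (intro mult_left_mono) auto
      then show ?thesis using 1 by (simp add: distrib_left)
    qed
    then show ?thesis by blast
  next
    case 2
    define \<delta> where "\<delta> = b - a1 \<bullet> \<mu>"
    define K where "K = (\<Sum>j\<in>J. \<bar>h j - T\<bar>) / \<delta>"
    have \<delta>: "0 < \<delta>" using base 2 by (simp add: \<delta>_def)
    have K: "0 \<le> K" using \<delta> by (simp add: K_def sum_nonneg)
    have "h j - (K *\<^sub>R a1) \<bullet> j \<le> T - (K *\<^sub>R a1) \<bullet> \<mu>" if "j \<in> J" for j
    proof -
      have "h j - T \<le> \<bar>h j - T\<bar>" by simp
      also have "\<dots> \<le> (\<Sum>j\<in>J. \<bar>h j - T\<bar>)" using fin that by (intro member_le_sum) auto
      also have "\<dots> = K * \<delta>" using \<delta> by (simp add: K_def)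
      also have "\<dots> \<le> K * (a1 \<bullet> j - a1 \<bullet> \<mu>)"
        using sep[OF that, of 0] 2 K by (intro mult_left_mono) (auto simp: \<delta>_def)
      finally show ?thesis by (simp add: algebra_simps)
    qed
    then show ?thesis by blast
  qed
qed simp

text \<open>
  The combination of point masses with weights \<open>p\<close> is the witness. Its mean is \<open>\<mu>\<close>, and its
  expectation of \<open>f\<close> is the weighted sum of the values \<open>f j\<close>, which may be infinite. The bound \<open>h\<close>
  may be negative, so it is compared through its positive part.
\<close>

lemma discrete_distribution_expectation:
  fixes f :: "real ^ 2 \<Rightarrow> ereal"
  assumes fin: "finite J" and p: "\<forall>j\<in>J. 0 \<le> p j" "sum p J = 1" "(\<Sum>j\<in>J. p j *\<^sub>R j) = \<mu>"
    and J: "J \<subseteq> Omega \<nu>"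
    and f: "f \<in> borel_measurable borel" "\<And>\<omega>. 0 \<le> f \<omega>" "\<And>j. j \<in> J \<Longrightarrow> ereal (h j) \<le> f j"
  shows "\<exists>P\<in>ambiguity \<nu> \<mu>. ereal (\<Sum>j\<in>J. p j * h j) \<le> ereal_expectation P f"
proof -
  define M where "M = point_measure J (\<lambda>j. ennreal (p j))"
  define P where "P = distr M borel (\<lambda>\<omega>. \<omega>)"
  have id: "(\<lambda>\<omega>. \<omega>) \<in> measurable M borel" by (simp add: M_def)
  interpret M: prob_space M
    by (rule prob_spaceI)
       (use fin p in \<open>simp add: M_def emeasure_point_measure_finite space_point_measure\<close>)
  have "prob_space P" unfolding P_def by (rule M.prob_space_distr[OF id])
  moreover have "integrable P (\<lambda>\<omega>. \<omega>)"
    unfolding P_def using fin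
    by (subst integrable_distr_eq[OF id]) (auto simp: M_def integrable_point_measure_finite)
  moreover have "integral\<^sup>L P (\<lambda>\<omega>. \<omega>) = \<mu>"
    unfolding P_def using fin p
    by (subst integral_distr[OF id]) (auto simp: M_def lebesgue_integral_point_measure_finite)
  moreover have "AE \<omega> in P. \<omega> \<in> Omega \<nu>"
  proof -
    have "Omega \<nu> \<in> sets borel"
      unfolding Omega_def by measurable
    moreover have "AE \<omega> in M. \<omega> \<in> Omega \<nu>"
      unfolding M_def AE_point_measure using J by blast
    ultimately show ?thesis
      unfolding P_def by (subst AE_distr_iff[OF id]) auto
  qed
  moreover have "sets P = sets borel" by (simp add: P_def)
  ultimately have mem: "P \<in> ambiguity \<nu> \<mu>" by (simp add: ambiguity_def)
  have neg: "(\<integral>\<^sup>+ \<omega>. e2ennreal (- f \<omega>) \<partial>P) = 0"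
    using f(2) by (simp add: e2ennreal_neg)
  have "ennreal (\<Sum>j\<in>J. p j * max 0 (h j)) = (\<Sum>j\<in>J. ennreal (p j) * ennreal (max 0 (h j)))"
    using p(1) by (subst sum_ennreal[symmetric]) (auto simp: ennreal_mult)
  also have "\<dots> \<le> (\<Sum>j\<in>J. ennreal (p j) * e2ennreal (f j))"
  proof (intro sum_mono mult_left_mono)
    fix j assume "j \<in> J"
    then have "ereal (max 0 (h j)) \<le> f j" using f(2,3) by (auto simp: max_def zero_ereal_def[symmetric])
    then show "ennreal (max 0 (h j)) \<le> e2ennreal (f j)"
      using e2ennreal_mono by fastforce
  qed simp
  also have "\<dots> = (\<integral>\<^sup>+ \<omega>. e2ennreal (f \<omega>) \<partial>P)"
    unfolding P_def using f(1) fin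
    by (subst nn_integral_distr[OF id]) (auto simp: M_def nn_integral_point_measure_finite)
  finally have le: "ennreal (\<Sum>j\<in>J. p j * max 0 (h j)) \<le> (\<integral>\<^sup>+ \<omega>. e2ennreal (f \<omega>) \<partial>P)" .
  have "ereal (\<Sum>j\<in>J. p j * h j) \<le> ereal (\<Sum>j\<in>J. p j * max 0 (h j))"
    using p(1) by (auto intro!: sum_mono mult_left_mono)
  also have "\<dots> = enn2ereal (ennreal (\<Sum>j\<in>J. p j * max 0 (h j)))"
    using p(1) by (intro enn2ereal_ennreal[symmetric] sum_nonneg) auto
  also have "\<dots> \<le> enn2ereal (\<integral>\<^sup>+ \<omega>. e2ennreal (f \<omega>) \<partial>P)"
    using le by (simp add: less_eq_ennreal.rep_eq)
  also have "\<dots> = ereal_expectation P f"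
    by (simp add: ereal_expectation_def neg zero_ennreal.rep_eq)
  finally show ?thesis using mem by blast
qed

section \<open>McCormick sets\<close>

text \<open>
  The four McCormick inequalities expand the nonnegative products of one slack of \<open>a\<close> and one
  slack of \<open>b\<close>.
\<close>

lemma mccormick_product:
  assumes "al \<le> a" "a \<le> au" "bl \<le> b" "b \<le> bu"
  shows "a * b \<in> mccormick al au bl bu a b"
proof -
  have "0 \<le> (a - al) * (b - bl)" "0 \<le> (au - a) * (bu - b)"
    "0 \<le> (a - al) * (bu - b)" "0 \<le> (au - a) * (b - bl)"
    using assms by simp_all
  then show ?thesis
    using assms by (auto simp: mccormick_def mc_slacks_def algebra_simps)
qed

lemma mccormick_binary:
  assumes "z \<in> mccormick 0 1 lo hi b \<pi>" "b \<in> {0, 1}"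
  shows "z = b * \<pi>"
  using assms by (auto simp: mccormick_def mc_slacks_def)

lemma mc_rows_nonneg_iff:
  "(\<forall>r\<in>mc_rows al au bl bu a b c. 0 \<le> r y x) \<longleftrightarrow>
     c y x \<in> mccormick al au bl bu (a y x) (b y x)"
proof -
  have "length (mc_slacks al au bl bu (a y x) (b y x) (c y x)) = 8"
    by (simp add: mc_slacks_def)
  then show ?thesis
    by (auto simp: mc_rows_def mccormick_def all_set_conv_all_nth)
qed

section \<open>Affine rows and the standard form\<close>

definition xvars :: "('n, 'm, 'e, 'd, 'g) network \<Rightarrow> ('n, 'm, 'e, 'd, 'g) xvar set" where
  "xvars N = nonneg_vars N \<union> free_vars N"

text \<open>
  Standard form reads off the coefficients of a row at the origin and at unit vectors. This
  recovers the row only if it is affine and involves no variable outside the network.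
\<close>

definition affine_row ::
    "('n, 'm, 'e, 'd, 'g) network \<Rightarrow> ('n, 'm, 'e, 'd, 'g) row \<Rightarrow> bool" where
  "affine_row N r \<longleftrightarrow> (\<exists>c G F. \<forall>y x.
     r y x = c + (\<Sum>k\<in>yvars N. G k * y k) + (\<Sum>v\<in>xvars N. F v * x v))"

lemma yvars_iff:
  "Za e \<in> yvars N \<longleftrightarrow> e \<in> ac_edges N" "Zg i \<in> yvars N \<longleftrightarrow> i \<in> gens N"
  "Rho i \<in> yvars N \<longleftrightarrow> i \<in> gens N" "RhoSq i \<in> yvars N \<longleftrightarrow> i \<in> gens N"
  by (auto simp: yvars_def)

lemma nonneg_vars_iff:
  "v \<in> nonneg_vars N \<longleftrightarrow>
     (case v of Delta i \<Rightarrow> i \<in> gens N | LpPlus i \<Rightarrow> i \<in> ac_nodes N | LpMinus i \<Rightarrow> i \<in> ac_nodes N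
      | LqPlus i \<Rightarrow> i \<in> ac_nodes N | LqMinus i \<Rightarrow> i \<in> ac_nodes N | It e \<Rightarrow> e \<in> trafos N
      | _ \<Rightarrow> False)"
  by (cases v) (auto simp: nonneg_vars_def)

lemma free_vars_iff:
  "v \<in> free_vars N \<longleftrightarrow>
     (case v of DeltaSq i \<Rightarrow> i \<in> gens N | Fp i \<Rightarrow> i \<in> gens N | Fq i \<Rightarrow> i \<in> gens N
      | Vm i \<Rightarrow> i \<in> ac_nodes N | Vsq i \<Rightarrow> i \<in> ac_nodes N | Qloss i \<Rightarrow> i \<in> ac_nodes N
      | WzF e \<Rightarrow> e \<in> ac_edges N | WzT e \<Rightarrow> e \<in> ac_edges N | Wc e \<Rightarrow> e \<in> ac_edges N
      | Ws e \<Rightarrow> e \<in> ac_edges N | Pf e \<Rightarrow> e \<in> ac_edges N | Qf e \<Rightarrow> e \<in> ac_edges N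
      | Pt e \<Rightarrow> e \<in> ac_edges N | Qt e \<Rightarrow> e \<in> ac_edges N | Vd m \<Rightarrow> m \<in> dc_nodes N
      | Vzd e \<Rightarrow> e \<in> dc_edges N | Id_cur e \<Rightarrow> e \<in> dc_edges N
      | Ud i e \<Rightarrow> i \<in> ac_nodes N \<and> e \<in> trafos_at N i
      | _ \<Rightarrow> False)"
  by (cases v) (auto simp: free_vars_def)

lemmas xvars_iff = xvars_def Un_iff nonneg_vars_iff free_vars_iff

lemma wf_networkD:
  assumes "wf_network N"
  shows "finite (ac_nodes N)" "finite (dc_nodes N)" "finite (ac_edges N)" "finite (dc_edges N)"
    "finite (gens N)"
    "\<And>e. e \<in> ac_edges N \<Longrightarrow> src N e \<in> ac_nodes N" "\<And>e. e \<in> ac_edges N \<Longrightarrow> dst N e \<in> ac_nodes N"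
    "\<And>e. e \<in> dc_edges N \<Longrightarrow> dsrc N e \<in> dc_nodes N" "\<And>e. e \<in> dc_edges N \<Longrightarrow> ddst N e \<in> dc_nodes N"
    "\<And>e. e \<in> dc_edges N \<Longrightarrow> ac_line N e \<in> ac_edges N"
    "trafos N \<subseteq> ac_edges N" "\<And>i. i \<in> ac_nodes N \<Longrightarrow> trafos_at N i \<subseteq> trafos N"
    "\<And>e. e \<in> trafos N \<Longrightarrow> set_transformer (trafo_type N e) \<subseteq> dc_edges N"
  using assms unfolding wf_network_def by (elim conjE; simp)+

lemma finite_vars:
  assumes "wf_network N"
  shows "finite (yvars N)" "finite (nonneg_vars N)" "finite (free_vars N)" "finite (xvars N)"
proof -
  note wf = wf_networkD[OF assms]
  have "finite (trafos N)" using wf(3,11) by (rule finite_subset[rotated])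
  moreover from this have "finite (trafos_at N i)" if "i \<in> ac_nodes N" for i
    using wf(12)[OF that] by (rule finite_subset[rotated])
  ultimately show "finite (yvars N)" "finite (nonneg_vars N)" "finite (free_vars N)" "finite (xvars N)"
    using wf(1-5) by (simp_all add: yvars_def nonneg_vars_def free_vars_def xvars_def)
qed

lemma sum_unit_at:
  assumes "finite A" "v \<in> A"
  shows "(\<Sum>u\<in>A. unit_at v u * f u) = f v" "(\<Sum>u\<in>A. f u * unit_at v u) = f v"
proof -
  have "unit_at v u * f u = (if u = v then f u else 0)" "f u * unit_at v u = (if u = v then f u else 0)" for u
    by (simp_all add: unit_at_def)
  then show "(\<Sum>u\<in>A. unit_at v u * f u) = f v" "(\<Sum>u\<in>A. f u * unit_at v u) = f v"
    using assms by simp_all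
qed

lemma affine_const: "affine_row N (\<lambda>y x. c)"
  unfolding affine_row_def by (rule exI[of _ c], rule exI[of _ "\<lambda>_. 0"], rule exI[of _ "\<lambda>_. 0"]) simp

lemma affine_yvar:
  assumes "wf_network N" "k \<in> yvars N"
  shows "affine_row N (\<lambda>y x. y k)"
  unfolding affine_row_def
  by (rule exI[of _ 0], rule exI[of _ "unit_at k"], rule exI[of _ "\<lambda>_. 0"])
     (simp add: sum_unit_at finite_vars assms)

lemma affine_xvar:
  assumes "wf_network N" "v \<in> xvars N"
  shows "affine_row N (\<lambda>y x. x v)"
  unfolding affine_row_def
  by (rule exI[of _ 0], rule exI[of _ "\<lambda>_. 0"], rule exI[of _ "unit_at v"])
     (simp add: sum_unit_at finite_vars assms)

lemma affine_add:
  assumes "affine_row N r" "affine_row N s"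
  shows "affine_row N (\<lambda>y x. r y x + s y x)"
proof -
  obtain c G F where 1: "\<And>y x. r y x = c + (\<Sum>k\<in>yvars N. G k * y k) + (\<Sum>v\<in>xvars N. F v * x v)"
    using assms(1) unfolding affine_row_def by blast
  obtain c' G' F' where 2: "\<And>y x. s y x = c' + (\<Sum>k\<in>yvars N. G' k * y k) + (\<Sum>v\<in>xvars N. F' v * x v)"
    using assms(2) unfolding affine_row_def by blast
  show ?thesis
    unfolding affine_row_def
    by (rule exI[of _ "c + c'"], rule exI[of _ "\<lambda>k. G k + G' k"], rule exI[of _ "\<lambda>v. F v + F' v"])
       (simp add: 1 2 sum.distrib distrib_right)
qed

lemma affine_scale:
  assumes "affine_row N r"
  shows "affine_row N (\<lambda>y x. a * r y x)"
proof -
  obtain c G F where 1: "\<And>y x. r y x = c + (\<Sum>k\<in>yvars N. G k * y k) + (\<Sum>v\<in>xvars N. F v * x v)"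
    using assms unfolding affine_row_def by blast
  show ?thesis
    unfolding affine_row_def
    by (rule exI[of _ "a * c"], rule exI[of _ "\<lambda>k. a * G k"], rule exI[of _ "\<lambda>v. a * F v"])
       (simp add: 1 sum_distrib_left distrib_left mult.assoc)
qed

lemma affine_scale_right: "affine_row N r \<Longrightarrow> affine_row N (\<lambda>y x. r y x * a)"
  using affine_scale[of N r a] by (simp add: mult.commute)

lemma affine_divide: "affine_row N r \<Longrightarrow> affine_row N (\<lambda>y x. r y x / a)"
  using affine_scale[of N r "1 / a"] by simp

lemma affine_uminus: "affine_row N r \<Longrightarrow> affine_row N (\<lambda>y x. - r y x)"
  using affine_scale[of N r "- 1"] by simp

lemma affine_diff:
  "affine_row N r \<Longrightarrow> affine_row N s \<Longrightarrow> affine_row N (\<lambda>y x. r y x - s y x)"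
  using affine_add[of N r "\<lambda>y x. - s y x"] affine_uminus[of N s] by simp

lemma affine_sum:
  "(\<And>i. i \<in> A \<Longrightarrow> affine_row N (r i)) \<Longrightarrow> affine_row N (\<lambda>y x. \<Sum>i\<in>A. r i y x)"
  by (induction A rule: infinite_finite_induct) (auto intro: affine_const affine_add)

lemma affine_case_prod:
  "(\<And>a b. affine_row N (f a b)) \<Longrightarrow> affine_row N (case_prod f t)"
  by (cases t) simp

lemma affine_eq_rows:
  "affine_row N r \<Longrightarrow> \<forall>r'\<in>eq_rows r. affine_row N r'"
  by (auto simp: eq_rows_def intro: affine_uminus)

lemma affine_mc_rows:
  assumes "affine_row N a" "affine_row N b" "affine_row N c"
  shows "\<forall>r\<in>mc_rows al au bl bu a b c. affine_row N r"
proof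
  fix r assume "r \<in> mc_rows al au bl bu a b c"
  then obtain k where k: "k < 8" "r = (\<lambda>y x. mc_slacks al au bl bu (a y x) (b y x) (c y x) ! k)"
    by (auto simp: mc_rows_def)
  have "k = 0 \<or> k = 1 \<or> k = 2 \<or> k = 3 \<or> k = 4 \<or> k = 5 \<or> k = 6 \<or> k = 7" using k(1) by linarith
  then show "affine_row N r"
    unfolding k(2) mc_slacks_def using assms
    by (elim disjE; hypsubst; simp only: nth_Cons_0 nth_Cons_numeral nth_Cons_Suc One_nat_def diff_Suc_1 numeral_nat Suc_numeral;
        intro affine_const affine_add affine_diff affine_scale)
qed

lemma affine_row_set:
  "\<forall>r\<in>{}. affine_row N r"
  "affine_row N r \<Longrightarrow> \<forall>r\<in>R. affine_row N r \<Longrightarrow> \<forall>r\<in>insert r R. affine_row N r"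
  "\<forall>r\<in>R. affine_row N r \<Longrightarrow> \<forall>r\<in>S. affine_row N r \<Longrightarrow> \<forall>r\<in>R \<union> S. affine_row N r"
  "(\<And>i. i \<in> I \<Longrightarrow> affine_row N (f i)) \<Longrightarrow> \<forall>r\<in>f ` I. affine_row N r"
  "(\<And>i. i \<in> I \<Longrightarrow> \<forall>r\<in>F i. affine_row N r) \<Longrightarrow> \<forall>r\<in>(\<Union>i\<in>I. F i). affine_row N r"
  by auto

lemmas affine_intros =
  affine_const affine_add affine_diff affine_uminus
  affine_scale affine_scale_right affine_divide affine_sum affine_case_prod
  affine_eq_rows affine_mc_rows affine_row_set

lemma affine_S_eff:
  assumes "wf_network N" "e \<in> trafos N"
  shows "affine_row N (\<lambda>y x. S_eff N (\<lambda>d. x (Id_cur d)) e)"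
proof -
  have "Id_cur d \<in> xvars N" if "d \<in> set_transformer (trafo_type N e)" for d
    using that wf_networkD(13)[OF assms] by (auto simp: xvars_iff)
  then show ?thesis
    unfolding S_eff_def using assms(1)
    by (cases "trafo_type N e") (auto intro!: affine_intros affine_xvar)
qed

lemma affine_gen_rows:
  assumes "wf_network N" "i \<in> gens N"
  shows "\<forall>r\<in>gen_rows N L i. affine_row N r"
proof -
  have "Zg i \<in> yvars N" "Rho i \<in> yvars N"
    "Delta i \<in> xvars N" "DeltaSq i \<in> xvars N" "Fp i \<in> xvars N" "Fq i \<in> xvars N"
    using assms(2)
    by (simp_all add: yvars_iff xvars_iff subset_iff)
  note vars = affine_yvar[OF assms(1) this(1)] affine_yvar[OF assms(1) this(2)]
    this(3-6)[THEN affine_xvar[OF assms(1)]]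
  show ?thesis
    unfolding gen_rows_def
    by (intro affine_intros vars)
qed

lemma affine_node_rows:
  assumes "wf_network N" "i \<in> ac_nodes N"
  shows "\<forall>r\<in>node_rows N L i. affine_row N r"
proof -
  have "Vm i \<in> xvars N" "Vsq i \<in> xvars N" "Qloss i \<in> xvars N" "LpPlus i \<in> xvars N"
    "LpMinus i \<in> xvars N" "LqPlus i \<in> xvars N" "LqMinus i \<in> xvars N"
    "\<And>e. e \<in> ac_edges N \<Longrightarrow> Pf e \<in> xvars N" "\<And>e. e \<in> ac_edges N \<Longrightarrow> Pt e \<in> xvars N"
    "\<And>e. e \<in> ac_edges N \<Longrightarrow> Qf e \<in> xvars N" "\<And>e. e \<in> ac_edges N \<Longrightarrow> Qt e \<in> xvars N"
    "\<And>k. k \<in> gens N \<Longrightarrow> Fp k \<in> xvars N" "\<And>k. k \<in> gens N \<Longrightarrow> Fq k \<in> xvars N"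
    "\<And>e. e \<in> trafos_at N i \<Longrightarrow> Ud i e \<in> xvars N" "\<And>e. e \<in> trafos_at N i \<Longrightarrow> It e \<in> xvars N"
    using wf_networkD[OF assms(1)] assms(2)
    by (simp_all add: yvars_iff xvars_iff subset_iff)
  note vars = this[THEN affine_xvar[OF assms(1)]]
  show ?thesis
    unfolding node_rows_def
    by (intro affine_intros vars) (auto simp: wf_networkD(8,9)[OF assms(1)])
qed

lemma affine_edge_rows:
  assumes "wf_network N" "e \<in> ac_edges N"
  shows "\<forall>r\<in>edge_rows N L e. affine_row N r"
proof -
  have "Za e \<in> yvars N" using assms(2) by (simp add: yvars_iff)
  note y = affine_yvar[OF assms(1) this]
  have "Vsq (src N e) \<in> xvars N" "Vsq (dst N e) \<in> xvars N" "WzF e \<in> xvars N" "WzT e \<in> xvars N"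
    "Wc e \<in> xvars N" "Ws e \<in> xvars N" "Pf e \<in> xvars N" "Pt e \<in> xvars N"
    "Qf e \<in> xvars N" "Qt e \<in> xvars N"
    using wf_networkD[OF assms(1)] assms(2)
    by (simp_all add: yvars_iff xvars_iff subset_iff)
  note vars = y this[THEN affine_xvar[OF assms(1)]]
  show ?thesis
    unfolding edge_rows_def flow_rows_def Let_def
    by (intro affine_intros vars)
qed

lemma affine_gic_rows:
  assumes "wf_network N"
  shows "\<forall>r\<in>gic_rows N L. affine_row N r"
proof -
  have "\<And>e. e \<in> dc_edges N \<Longrightarrow> Za (ac_line N e) \<in> yvars N"
    using wf_networkD[OF assms(1)] by (simp add: yvars_iff)
  note y = affine_yvar[OF assms(1) this]
  have "\<And>m. m \<in> dc_nodes N \<Longrightarrow> Vd m \<in> xvars N"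
    "\<And>e. e \<in> dc_edges N \<Longrightarrow> Vd (dsrc N e) \<in> xvars N"
    "\<And>e. e \<in> dc_edges N \<Longrightarrow> Vd (ddst N e) \<in> xvars N"
    "\<And>e. e \<in> dc_edges N \<Longrightarrow> Id_cur e \<in> xvars N"
    "\<And>e. e \<in> dc_edges N \<Longrightarrow> Vzd e \<in> xvars N"
    "\<And>e. e \<in> trafos N \<Longrightarrow> It e \<in> xvars N"
    using wf_networkD[OF assms(1)]
    by (simp_all add: yvars_iff xvars_iff subset_iff)
  note vars = y this[THEN affine_xvar[OF assms(1)]] affine_S_eff[OF assms(1)]
  show ?thesis
    unfolding gic_rows_def net_inflow_def
    by (intro affine_intros vars) (auto simp: wf_networkD(8,9)[OF assms(1)])
qed

lemma affine_rows: "wf_network N \<Longrightarrow> r \<in> rows N L \<Longrightarrow> affine_row N r"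
  unfolding rows_def
  by (auto simp: affine_gen_rows affine_node_rows affine_edge_rows affine_gic_rows)

text \<open>
  The coefficients in \<open>G_mat\<close>, \<open>E_mat\<close> and \<open>h_vec\<close> reproduce an affine row, so that feasibility in
  standard form can be checked on the constraints as they were written.
\<close>

lemma affine_row_eval:
  assumes "wf_network N" "affine_row N r"
  shows "(\<Sum>k\<in>yvars N. G_mat r k * y k)
      + (\<Sum>v\<in>xvars N. (r (\<lambda>_. 0) (unit_at v) - r (\<lambda>_. 0) (\<lambda>_. 0)) * x v) = r y x + h_vec r"
proof -
  obtain c G F where r: "\<And>y x. r y x = c + (\<Sum>k\<in>yvars N. G k * y k) + (\<Sum>v\<in>xvars N. F v * x v)"
    using assms(2) unfolding affine_row_def by blast
  have "G_mat r k = G k" if "k \<in> yvars N" for k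
    using that by (simp add: G_mat_def r sum_unit_at finite_vars assms(1))
  moreover have "r (\<lambda>_. 0) (unit_at v) - r (\<lambda>_. 0) (\<lambda>_. 0) = F v" if "v \<in> xvars N" for v
    using that by (simp add: r sum_unit_at finite_vars assms(1))
  ultimately show ?thesis by (simp add: h_vec_def r cong: sum.cong)
qed

text \<open>A point in the variables before splitting, in its canonical split form.\<close>

fun split_point ::
    "('n, 'm, 'e, 'd, 'g) network \<Rightarrow> (('n, 'm, 'e, 'd, 'g) xvar \<Rightarrow> real) \<Rightarrow>
     ('n, 'm, 'e, 'd, 'g) xvar col \<Rightarrow> real" where
  "split_point N x (Pos v) = (if v \<in> free_vars N then max 0 (x v) else x v)"
| "split_point N x (Neg v) = max 0 (- x v)"

lemma sum_cols_split_point: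
  assumes "wf_network N"
  shows "(\<Sum>c\<in>cols N. split_coeff f c * split_point N x c) = (\<Sum>v\<in>xvars N. f v * x v)"
proof -
  let ?p = "\<lambda>c. split_coeff f c * split_point N x c"
  have "(\<Sum>c\<in>cols N. ?p c) = (\<Sum>c\<in>Pos ` xvars N. ?p c) + (\<Sum>c\<in>Neg ` free_vars N. ?p c)"
    unfolding cols_def xvars_def[symmetric]
    by (rule sum.union_disjoint) (auto simp: finite_vars assms)
  also have "(\<Sum>c\<in>Pos ` xvars N. ?p c) = (\<Sum>v\<in>xvars N. ?p (Pos v))"
    by (subst sum.reindex) (auto simp: inj_on_def)
  also have "(\<Sum>c\<in>Neg ` free_vars N. ?p c) = (\<Sum>v\<in>free_vars N. ?p (Neg v))"
    by (subst sum.reindex) (auto simp: inj_on_def)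
  also have "\<dots> = (\<Sum>v\<in>xvars N. if v \<in> free_vars N then ?p (Neg v) else 0)"
    using finite_vars[OF assms]
    by (intro sum.mono_neutral_cong_left) (auto simp: xvars_def)
  also have "(\<Sum>v\<in>xvars N. ?p (Pos v)) + (\<Sum>v\<in>xvars N. if v \<in> free_vars N then ?p (Neg v) else 0)
      = (\<Sum>v\<in>xvars N. f v * x v)"
    unfolding sum.distrib[symmetric]
    by (intro sum.cong refl) (auto simp: max_def algebra_simps)
  finally show ?thesis .
qed

lemma split_point_in_lin_second_stage:
  assumes "wf_network N"
    and nonneg: "\<And>v. v \<in> nonneg_vars N \<Longrightarrow> 0 \<le> x v"
    and rows: "\<And>r. r \<in> rows N L \<Longrightarrow> 0 \<le> r y x"
    and source: "\<And>e. e \<in> dc_edges N \<Longrightarrow>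
      y (Za (ac_line N e)) * adm N e * induced N \<omega> e = x (Id_cur e) - adm N e * x (Vzd e)"
  shows "split_point N x \<in> lin_second_stage N L y \<omega>"
proof -
  have "0 \<le> split_point N x c" if "c \<in> cols N" for c
    using that nonneg by (auto simp: cols_def)
  moreover have "h_vec r \<le> (\<Sum>k\<in>yvars N. G_mat r k * y k) + (\<Sum>c\<in>cols N. E_mat r c * split_point N x c)"
    if "r \<in> rows N L" for r
    using rows[OF that] affine_row_eval[OF assms(1) affine_rows[OF assms(1) that], of y x]
    by (simp add: E_mat_def sum_cols_split_point[OF assms(1)])
  moreover have "(\<Sum>k\<in>yvars N. (\<Sum>i\<in>UNIV. T_mat N i e k * \<omega> $ i) * y k) =
      (\<Sum>c\<in>cols N. W_mat N e c * split_point N x c)" if e: "e \<in> dc_edges N" for e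
  proof -
    have "(\<Sum>k\<in>yvars N. (\<Sum>i\<in>UNIV. T_mat N i e k * \<omega> $ i) * y k)
        = (\<Sum>k\<in>yvars N. unit_at (Za (ac_line N e)) k * (adm N e * induced N \<omega> e * y k))"
      by (intro sum.cong refl)
         (auto simp: T_mat_def unit_at_def sum_2 induced_def algebra_simps)
    also have "\<dots> = y (Za (ac_line N e)) * adm N e * induced N \<omega> e"
      using wf_networkD(10)[OF assms(1) e]
      by (subst sum_unit_at) (auto simp: finite_vars assms(1) yvars_iff)
    also have "\<dots> = x (Id_cur e) - adm N e * x (Vzd e)" by (rule source[OF e])
    also have "\<dots> = (\<Sum>v\<in>xvars N. (unit_at (Id_cur e) v - adm N e * unit_at (Vzd e) v) * x v)"
      using e
      by (simp add: left_diff_distrib sum_subtractf mult.assoc sum_distrib_left[symmetric]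
          sum_unit_at finite_vars assms(1) xvars_iff)
    finally show ?thesis
      by (simp add: W_mat_def sum_cols_split_point[OF assms(1)])
  qed
  ultimately show ?thesis by (simp add: lin_second_stage_def)
qed

section \<open>Lifting an operating point into the linearization\<close>

fun first_stage_point :: "('e \<Rightarrow> real) \<Rightarrow> ('g \<Rightarrow> real) \<Rightarrow> ('g \<Rightarrow> real) \<Rightarrow> ('e, 'g) yvar \<Rightarrow> real" where
  "first_stage_point za zg \<rho> (Za e) = za e"
| "first_stage_point za zg \<rho> (Zg i) = zg i"
| "first_stage_point za zg \<rho> (Rho i) = \<rho> i"
| "first_stage_point za zg \<rho> (RhoSq i) = (\<rho> i)\<^sup>2"

text \<open>
  Every auxiliary variable takes the value of the expression it replaces, except that \<open>\<Delta>\<close> and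
  \<open>\<Delta>\<^sup>2\<close> are multiplied by \<open>z\<^sup>g\<close>. The tangent cuts \<open>2 \<ell> \<Delta> - z\<^sup>g \<ell>\<^sup>2\<close> lose their constant term for a
  generator that is off, and a small \<open>\<Delta> > 0\<close> may then violate \<open>\<Delta>\<^sup>2 \<ge> 2 \<ell> \<Delta>\<close>. Such a generator
  has \<open>f\<^sup>p = \<rho> = 0\<close>, so its \<open>\<Delta>\<close> may be lowered to 0 without raising the cost.
\<close>

fun lifted_point ::
    "('n, 'm, 'e, 'd, 'g) network \<Rightarrow> ('e \<Rightarrow> real) \<Rightarrow> ('g \<Rightarrow> real) \<Rightarrow>
     ('n, 'm, 'e, 'd, 'g) decision \<Rightarrow> ('n, 'm, 'e, 'd, 'g) xvar \<Rightarrow> real" where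
  "lifted_point N za zg s (Delta i) = zg i * ds_Delta s i"
| "lifted_point N za zg s (DeltaSq i) = zg i * (ds_Delta s i)\<^sup>2"
| "lifted_point N za zg s (Fp i) = ds_fp s i"
| "lifted_point N za zg s (Fq i) = ds_fq s i"
| "lifted_point N za zg s (LpPlus i) = ds_lp_plus s i"
| "lifted_point N za zg s (LpMinus i) = ds_lp_minus s i"
| "lifted_point N za zg s (LqPlus i) = ds_lq_plus s i"
| "lifted_point N za zg s (LqMinus i) = ds_lq_minus s i"
| "lifted_point N za zg s (Vm i) = ds_v s i"
| "lifted_point N za zg s (Vsq i) = (ds_v s i)\<^sup>2"
| "lifted_point N za zg s (WzF e) = za e * (ds_v s (src N e))\<^sup>2"
| "lifted_point N za zg s (WzT e) = za e * (ds_v s (dst N e))\<^sup>2"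
| "lifted_point N za zg s (Wc e) = za e * (ds_v s (src N e) * ds_v s (dst N e) *
     cos (ds_theta s (src N e) - ds_theta s (dst N e)))"
| "lifted_point N za zg s (Ws e) = za e * (ds_v s (src N e) * ds_v s (dst N e) *
     sin (ds_theta s (src N e) - ds_theta s (dst N e)))"
| "lifted_point N za zg s (Pf e) = ds_pf s e"
| "lifted_point N za zg s (Qf e) = ds_qf s e"
| "lifted_point N za zg s (Pt e) = ds_pt s e"
| "lifted_point N za zg s (Qt e) = ds_qt s e"
| "lifted_point N za zg s (Vd m) = ds_vd s m"
| "lifted_point N za zg s (Vzd d) = za (ac_line N d) * (ds_vd s (dsrc N d) - ds_vd s (ddst N d))"
| "lifted_point N za zg s (Id_cur d) = ds_Id s d"
| "lifted_point N za zg s (It e) = ds_It s e"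
| "lifted_point N za zg s (Ud i e) = ds_v s i * ds_It s e"
| "lifted_point N za zg s (Qloss i) = ds_qloss s i"

lemma eq_rows_nonneg_iff: "(\<forall>r'\<in>eq_rows r. 0 \<le> r' y x) \<longleftrightarrow> r y x = 0"
  by (auto simp: eq_rows_def)

lemma tangent_below_square: "2 * l * t - l\<^sup>2 \<le> (t::real)\<^sup>2"
  using zero_le_power2[of "t - l"] by (simp add: power2_diff algebra_simps)

lemma first_stage_point_feasible:
  assumes "first_stage N za zg \<rho>"
  shows "y_feasible N L (first_stage_point za zg \<rho>)"
proof -
  have "2 * \<rho> i * l - zg i * l\<^sup>2 \<le> (\<rho> i)\<^sup>2" if "i \<in> gens N" for i l
  proof -
    have "zg i = 0 \<and> \<rho> i = 0 \<or> zg i = 1" using assms that by (force simp: first_stage_def)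
    then show ?thesis using tangent_below_square[of l "\<rho> i"] by (auto simp: mult_ac)
  qed
  then show ?thesis using assms by (simp add: y_feasible_def)
qed

lemma gen_rows_lifted_point:
  assumes "first_stage N za zg \<rho>" "gen_constraints N zg \<rho> s" "i \<in> gens N"
  shows "\<forall>r\<in>gen_rows N L i. 0 \<le> r (first_stage_point za zg \<rho>) (lifted_point N za zg s)"
proof -
  have z: "zg i = 0 \<or> zg i = 1" and \<rho>: "zg i * gp_lo N i \<le> \<rho> i" "\<rho> i \<le> zg i * gp_hi N i"
    using assms(1,3) by (auto simp: first_stage_def)
  have c: "0 \<le> ds_Delta s i" "ds_fp s i - \<rho> i \<le> ds_Delta s i"
     "zg i * gp_lo N i \<le> ds_fp s i" "ds_fp s i \<le> zg i * gp_hi N i"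
     "zg i * gq_lo N i \<le> ds_fq s i" "ds_fq s i \<le> zg i * gq_hi N i"
     "\<bar>ds_fp s i - \<rho> i\<bar> \<le> zg i * ramp N i * gp_hi N i"
    using assms(2,3) by (auto simp: gen_constraints_def)
  have "ds_fp s i - \<rho> i \<le> zg i * ds_Delta s i" using z c \<rho> by auto
  moreover have "2 * l * (zg i * ds_Delta s i) - zg i * l\<^sup>2 \<le> zg i * (ds_Delta s i)\<^sup>2" for l
    using z tangent_below_square[of l "ds_Delta s i"] by auto
  ultimately show ?thesis
    using c(3-7) by (auto simp: gen_rows_def abs_le_iff)
qed

lemma node_rows_lifted_point:
  assumes "wf_network N" "node_constraints N s" "gic_constraints N za \<omega> s" "i \<in> ac_nodes N"
  shows "\<forall>r\<in>node_rows N L i. 0 \<le> r y (lifted_point N za zg s)"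
proof -
  have v: "v_lo N i \<le> ds_v s i" "ds_v s i \<le> v_hi N i"
    and bal: "(\<Sum>e | e \<in> ac_edges N \<and> src N e = i. ds_pf s e) +
       (\<Sum>e | e \<in> ac_edges N \<and> dst N e = i. ds_pt s e) =
       (\<Sum>k | k \<in> gens N \<and> gen_bus N k = i. ds_fp s k) - dem_p N i
         + ds_lp_plus s i - ds_lp_minus s i - (ds_v s i)\<^sup>2 * shunt_g N i"
     "(\<Sum>e | e \<in> ac_edges N \<and> src N e = i. ds_qf s e) +
       (\<Sum>e | e \<in> ac_edges N \<and> dst N e = i. ds_qt s e) =
       (\<Sum>k | k \<in> gens N \<and> gen_bus N k = i. ds_fq s k) - dem_q N i - ds_qloss s i
         + ds_lq_plus s i - ds_lq_minus s i + (ds_v s i)\<^sup>2 * shunt_b N i"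
    using assms(2,4) unfolding node_constraints_def by blast+
  have loss: "ds_qloss s i = (\<Sum>e\<in>trafos_at N i. loss_factor N e * ds_v s i * ds_It s e)"
    and It: "\<And>e. e \<in> trafos_at N i \<Longrightarrow> 0 \<le> ds_It s e \<and> ds_It s e \<le> I_max N"
    using assms(3,4) wf_networkD(12)[OF assms(1,4)] unfolding gic_constraints_def by blast+
  have "0 \<le> (v_hi N i - ds_v s i) * (ds_v s i - v_lo N i)" using v by simp
  then have chord: "(ds_v s i)\<^sup>2 \<le> (v_hi N i + v_lo N i) * ds_v s i - v_hi N i * v_lo N i"
    by (simp add: algebra_simps power2_eq_square)
  have ud: "ds_v s i * ds_It s e \<in> mccormick (v_lo N i) (v_hi N i) 0 (I_max N) (ds_v s i) (ds_It s e)"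
    if "e \<in> trafos_at N i" for e
    using v It[OF that] by (intro mccormick_product) auto
  show ?thesis
    unfolding node_rows_def ball_Un eq_rows_nonneg_iff
    using v bal loss chord ud tangent_below_square[of _ "ds_v s i"]
    by (simp add: mc_rows_nonneg_iff mult.assoc)
qed

lemma flow_rows_lifted_point:
  assumes "flow_constraints N za s" "e \<in> ac_edges N"
  shows "\<forall>r\<in>flow_rows N e. 0 \<le> r y (lifted_point N za zg s)"
  using assms unfolding flow_rows_def flow_constraints_def Let_def ball_Un eq_rows_nonneg_iff
  by (simp add: algebra_simps)

text \<open>
  On an open edge all quantities vanish. On a closed edge the angle limit puts the operating
  point in the range for which the bounds on \<open>w\<^sup>c\<close>, \<open>w\<^sup>s\<close> and the cone cuts are valid, and the
  thermal cuts are tangents of the quadratic limits.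
\<close>

lemma edge_rows_lifted_point:
  assumes wf: "wf_network N" and L: "valid_w_bounds N L" "valid_cone_cuts N L"
    and fs: "first_stage N za zg \<rho>" and s: "node_constraints N s" "flow_constraints N za s"
    and e: "e \<in> ac_edges N"
  shows "\<forall>r\<in>edge_rows N L e. 0 \<le> r (first_stage_point za zg \<rho>) (lifted_point N za zg s)"
proof -
  define vi vj \<theta> where "vi = ds_v s (src N e)" and "vj = ds_v s (dst N e)"
    and "\<theta> = ds_theta s (src N e) - ds_theta s (dst N e)"
  note abbr = vi_def[symmetric] vj_def[symmetric] \<theta>_def[symmetric]
  have z: "za e = 0 \<or> za e = 1" using fs e by (auto simp: first_stage_def)
  note ends = wf_networkD(6,7)[OF wf e]
  have vlo: "0 < v_lo N (src N e)" "0 < v_lo N (dst N e)"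
    and tm: "0 < theta_max N" "theta_max N < pi / 2"
    using wf ends unfolding wf_network_def by simp_all
  have v: "v_lo N (src N e) \<le> vi" "vi \<le> v_hi N (src N e)"
     "v_lo N (dst N e) \<le> vj" "vj \<le> v_hi N (dst N e)"
    using s(1) ends unfolding node_constraints_def vi_def vj_def by simp_all
  have sq: "(v_lo N (src N e))\<^sup>2 \<le> vi\<^sup>2" "vi\<^sup>2 \<le> (v_hi N (src N e))\<^sup>2"
     "(v_lo N (dst N e))\<^sup>2 \<le> vj\<^sup>2" "vj\<^sup>2 \<le> (v_hi N (dst N e))\<^sup>2"
    using v vlo by (auto intro!: power_mono)
  have fl: "za e = 0 \<Longrightarrow> ds_pf s e = 0 \<and> ds_qf s e = 0 \<and> ds_pt s e = 0 \<and> ds_qt s e = 0"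
    "za e * \<bar>\<theta>\<bar> \<le> theta_max N"
    "(ds_pf s e)\<^sup>2 + (ds_qf s e)\<^sup>2 \<le> za e * (s_max N e)\<^sup>2"
    "(ds_pt s e)\<^sup>2 + (ds_qt s e)\<^sup>2 \<le> za e * (s_max N e)\<^sup>2"
    using s(2) e unfolding flow_constraints_def Let_def \<theta>_def by auto
  have range: "(vi, vj, \<theta>) \<in> voltage_angle_range N e" if "za e = 1"
    using v fl(2) that by (auto simp: voltage_angle_range_def abs_le_iff)
  have w: "za e * wc_lo L e \<le> za e * (vi * vj * cos \<theta>)" "za e * (vi * vj * cos \<theta>) \<le> za e * wc_hi L e"
    "za e * ws_lo L e \<le> za e * (vi * vj * sin \<theta>)" "za e * (vi * vj * sin \<theta>) \<le> za e * ws_hi L e"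
    using z range L(1) e unfolding valid_w_bounds_def by fastforce+
  \<comment> \<open>On a closed edge, the two rows are sines of angles between 0 and \<open>pi\<close>, up to the positive
    factor \<open>v\<^sub>i v\<^sub>j / cos\<close> of the angle bound.\<close>
  have angle: "0 \<le> za e * (vi * vj * sin \<theta>) + tan (theta_max N) * (za e * (vi * vj * cos \<theta>))"
      "0 \<le> tan (theta_max N) * (za e * (vi * vj * cos \<theta>)) - za e * (vi * vj * sin \<theta>)"
  proof -
    let ?t = "theta_max N"
    have c: "0 < cos ?t" using tm by (intro cos_gt_zero_pi) auto
    have sin: "0 \<le> sin (?t + \<theta>)" "0 \<le> sin (?t - \<theta>)" if "za e = 1"
      using fl(2) tm that by (auto intro!: sin_ge_zero simp: abs_le_iff)
    have "za e * (vi * vj * sin \<theta>) + tan ?t * (za e * (vi * vj * cos \<theta>))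
        = za e * (vi * vj * sin (?t + \<theta>)) / cos ?t"
      "tan ?t * (za e * (vi * vj * cos \<theta>)) - za e * (vi * vj * sin \<theta>)
        = za e * (vi * vj * sin (?t - \<theta>)) / cos ?t"
      using c by (simp_all add: tan_def sin_add sin_diff field_simps)
    moreover have "0 \<le> za e * (vi * vj * sin (?t + \<theta>)) / cos ?t"
      "0 \<le> za e * (vi * vj * sin (?t - \<theta>)) / cos ?t"
      using z sin c v vlo by auto
    ultimately show "0 \<le> za e * (vi * vj * sin \<theta>) + tan ?t * (za e * (vi * vj * cos \<theta>))"
      "0 \<le> tan ?t * (za e * (vi * vj * cos \<theta>)) - za e * (vi * vj * sin \<theta>)" by simp_all
  qed
  have cone: "2 * (za e * (vi * vj * cos \<theta>) * lc + za e * (vi * vj * sin \<theta>) * ls)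
        - za e * vi\<^sup>2 * lt - za e * vj\<^sup>2 * lf \<le> za e * (lc\<^sup>2 + ls\<^sup>2 - lf * lt)"
    if "lc \<in> L_wc L e" "ls \<in> L_ws L e" "lf \<in> L_w L (src N e)" "lt \<in> L_w L (dst N e)" for lc ls lf lt
    using z
  proof
    assume "za e = 1"
    with range L(2) e that show ?thesis unfolding valid_cone_cuts_def by fastforce
  qed simp
  have thermal: "2 * p * lp + 2 * q * lq \<le> za e * ((s_max N e)\<^sup>2 + lp\<^sup>2 + lq\<^sup>2)"
    if "za e = 0 \<Longrightarrow> p = 0 \<and> q = 0" "p\<^sup>2 + q\<^sup>2 \<le> za e * (s_max N e)\<^sup>2" for p q lp lq
    using z
  proof
    assume "za e = 1"
    then show ?thesis
      using that(2) tangent_below_square[of lp p] tangent_below_square[of lq q] by (simp add: mult_ac)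
  qed (use that in simp)
  have mc: "za e * vi\<^sup>2 \<in> mccormick 0 1 ((v_lo N (src N e))\<^sup>2) ((v_hi N (src N e))\<^sup>2) (za e) (vi\<^sup>2)"
    "za e * vj\<^sup>2 \<in> mccormick 0 1 ((v_lo N (dst N e))\<^sup>2) ((v_hi N (dst N e))\<^sup>2) (za e) (vj\<^sup>2)"
    using z sq by (auto intro!: mccormick_product)
  show ?thesis
    unfolding edge_rows_def ball_Un mc_rows_nonneg_iff
    using flow_rows_lifted_point[OF s(2) e, of "first_stage_point za zg \<rho>" zg] w angle cone
      thermal[of "ds_pf s e" "ds_qf s e", OF _ fl(3)] thermal[of "ds_pt s e" "ds_qt s e", OF _ fl(4)] fl(1) mc
    by (simp add: abbr)
qed

lemma gic_rows_lifted_point: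
  assumes wf: "wf_network N" and fs: "first_stage N za zg \<rho>" and s: "gic_constraints N za \<omega> s"
    and dv: "\<forall>e\<in>dc_edges N. ds_vd s (dsrc N e) - ds_vd s (ddst N e) \<in> {dv_lo L e..dv_hi L e}"
  shows "\<forall>r\<in>gic_rows N L. 0 \<le> r (first_stage_point za zg \<rho>) (lifted_point N za zg s)"
proof -
  have "za (ac_line N e) * (ds_vd s (dsrc N e) - ds_vd s (ddst N e))
      \<in> mccormick 0 1 (dv_lo L e) (dv_hi L e) (za (ac_line N e)) (ds_vd s (dsrc N e) - ds_vd s (ddst N e))"
    if "e \<in> dc_edges N" for e
    using that dv fs wf_networkD(10)[OF wf that]
    by (intro mccormick_product) (auto simp: first_stage_def)
  moreover have "0 \<le> ds_It s e + S_eff N (ds_Id s) e" if "e \<in> trafos N" for e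
    using that s by (auto simp: gic_constraints_def)
  ultimately show ?thesis
    using s unfolding gic_rows_def ball_Un gic_constraints_def
    by (simp add: mc_rows_nonneg_iff eq_rows_nonneg_iff)
qed

lemma lifted_point_cost:
  assumes "wf_network N"
  shows "(\<Sum>c\<in>cols N. c_vec N c * split_point N (lifted_point N za zg s) c)
    = (\<Sum>i\<in>gens N. costR2 N i * (zg i * (ds_Delta s i)\<^sup>2) + costR1 N i * (zg i * ds_Delta s i))
      + (\<Sum>i\<in>ac_nodes N. shed_cost N i *
        (ds_lp_plus s i + ds_lq_plus s i + ds_lp_minus s i + ds_lq_minus s i))"
proof -
  define f where "f = (\<lambda>v :: ('a, 'b, 'c, 'd, 'e) xvar. case v of
       DeltaSq i \<Rightarrow> costR2 N i | Delta i \<Rightarrow> costR1 N i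
     | LpPlus i \<Rightarrow> shed_cost N i | LpMinus i \<Rightarrow> shed_cost N i
     | LqPlus i \<Rightarrow> shed_cost N i | LqMinus i \<Rightarrow> shed_cost N i | _ \<Rightarrow> 0)"
  let ?g = "\<lambda>v. f v * lifted_point N za zg s v"
  define U :: "('a, 'b, 'c, 'd, 'e) xvar set" where
    "U = Delta ` gens N \<union> DeltaSq ` gens N \<union> LpPlus ` ac_nodes N
     \<union> LpMinus ` ac_nodes N \<union> LqPlus ` ac_nodes N \<union> LqMinus ` ac_nodes N"
  note fin = wf_networkD(1,5)[OF assms]
  have "(\<Sum>c\<in>cols N. c_vec N c * split_point N (lifted_point N za zg s) c) = (\<Sum>v\<in>xvars N. ?g v)"
    unfolding c_vec_def f_def by (rule sum_cols_split_point[OF assms])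
  \<comment> \<open>All other variables have cost 0.\<close>
  also have "\<dots> = (\<Sum>v\<in>U. ?g v)"
  proof (rule sum.mono_neutral_right)
    show "finite (xvars N)" using finite_vars[OF assms] by simp
    show "U \<subseteq> xvars N"
      by (auto simp: U_def xvars_iff)
    show "\<forall>v\<in>xvars N - U. ?g v = 0"
    proof
      fix v assume "v \<in> xvars N - U"
      then show "?g v = 0" by (cases v) (auto simp: U_def xvars_iff f_def)
    qed
  qed
  also have "\<dots> = (\<Sum>i\<in>gens N. ?g (Delta i)) + (\<Sum>i\<in>gens N. ?g (DeltaSq i))
     + (\<Sum>i\<in>ac_nodes N. ?g (LpPlus i)) + (\<Sum>i\<in>ac_nodes N. ?g (LpMinus i))
     + (\<Sum>i\<in>ac_nodes N. ?g (LqPlus i)) + (\<Sum>i\<in>ac_nodes N. ?g (LqMinus i))"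
    unfolding U_def using fin
    by (subst sum.union_disjoint; (auto; fail)?)+ (simp add: sum.reindex inj_on_def)
  also have "\<dots> = (\<Sum>i\<in>gens N. costR2 N i * (zg i * (ds_Delta s i)\<^sup>2) + costR1 N i * (zg i * ds_Delta s i))
      + (\<Sum>i\<in>ac_nodes N. shed_cost N i *
        (ds_lp_plus s i + ds_lq_plus s i + ds_lp_minus s i + ds_lq_minus s i))"
    by (simp add: f_def sum.distrib distrib_left)
  finally show ?thesis .
qed

lemma lifted_point_cost_le:
  assumes wf: "wf_network N" and fs: "first_stage N za zg \<rho>" and s: "gen_constraints N zg \<rho> s"
  shows "(\<Sum>c\<in>cols N. c_vec N c * split_point N (lifted_point N za zg s) c) \<le> second_cost N s"
proof -
  have "costR2 N i * (zg i * (ds_Delta s i)\<^sup>2) + costR1 N i * (zg i * ds_Delta s i)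
      \<le> costR2 N i * (ds_Delta s i)\<^sup>2 + costR1 N i * ds_Delta s i" if "i \<in> gens N" for i
  proof -
    have "0 \<le> costR1 N i" "0 \<le> costR2 N i" using wf that unfolding wf_network_def by simp_all
    moreover have "zg i = 0 \<or> zg i = 1" using fs that by (auto simp: first_stage_def)
    moreover have "0 \<le> ds_Delta s i" using s that by (simp add: gen_constraints_def)
    ultimately show ?thesis by auto
  qed
  then show ?thesis
    unfolding lifted_point_cost[OF wf] second_cost_def by (intro add_right_mono sum_mono)
qed

lemma lifted_point_feasible:
  assumes wf: "wf_network N" and L: "valid_w_bounds N L" "valid_cone_cuts N L"
    and fs: "first_stage N za zg \<rho>" and s: "s \<in> second_stage N za zg \<rho> \<omega>"
    and dv: "\<forall>e\<in>dc_edges N. ds_vd s (dsrc N e) - ds_vd s (ddst N e) \<in> {dv_lo L e..dv_hi L e}"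
  shows "split_point N (lifted_point N za zg s)
    \<in> lin_second_stage N L (first_stage_point za zg \<rho>) \<omega>"
proof (rule split_point_in_lin_second_stage[OF wf])
  have gen: "gen_constraints N zg \<rho> s" and node: "node_constraints N s"
    and flow: "flow_constraints N za s" and gic: "gic_constraints N za \<omega> s"
    using s by (simp_all add: second_stage_def)
  show "0 \<le> lifted_point N za zg s v" if "v \<in> nonneg_vars N" for v
  proof -
    have "0 \<le> zg i * ds_Delta s i" if "i \<in> gens N" for i
      using that gen fs by (auto simp: gen_constraints_def first_stage_def)
    then show ?thesis
      using that node gic by (cases v) (simp_all add: nonneg_vars_iff node_constraints_def gic_constraints_def)
  qed
  show "0 \<le> r (first_stage_point za zg \<rho>) (lifted_point N za zg s)" if "r \<in> rows N L" for r
    using that gen_rows_lifted_point[OF fs gen] node_rows_lifted_point[OF wf node gic]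
      edge_rows_lifted_point[OF wf L fs node flow] gic_rows_lifted_point[OF wf fs gic dv]
    unfolding rows_def by blast
  show "first_stage_point za zg \<rho> (Za (ac_line N e)) * adm N e * induced N \<omega> e
      = lifted_point N za zg s (Id_cur e) - adm N e * lifted_point N za zg s (Vzd e)"
    if "e \<in> dc_edges N" for e
    using gic that by (simp add: gic_constraints_def algebra_simps)
qed

section \<open>Linear programming duality at a vertex\<close>

lemma weak_duality:
  fixes E :: "'r \<Rightarrow> 'c \<Rightarrow> real" and W :: "'s \<Rightarrow> 'c \<Rightarrow> real"
  assumes x: "\<forall>c\<in>C. 0 \<le> x c"
    and ineq: "\<forall>r\<in>R. b r \<le> (\<Sum>c\<in>C. E r c * x c)"
    and eq: "\<forall>s\<in>S. t s = (\<Sum>c\<in>C. W s c * x c)"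
    and dual: "\<forall>c\<in>C. (\<Sum>r\<in>R. E r c * \<gamma> r) + (\<Sum>s\<in>S. W s c * \<pi> s) \<le> cost c"
    and \<gamma>: "\<forall>r\<in>R. 0 \<le> \<gamma> r"
  shows "(\<Sum>r\<in>R. b r * \<gamma> r) + (\<Sum>s\<in>S. t s * \<pi> s) \<le> (\<Sum>c\<in>C. cost c * x c)"
proof -
  have "(\<Sum>r\<in>R. b r * \<gamma> r) + (\<Sum>s\<in>S. t s * \<pi> s)
      \<le> (\<Sum>r\<in>R. (\<Sum>c\<in>C. E r c * x c) * \<gamma> r) + (\<Sum>s\<in>S. (\<Sum>c\<in>C. W s c * x c) * \<pi> s)"
    using ineq eq \<gamma> by (intro add_mono sum_mono) (auto intro: mult_right_mono)
  also have "\<dots> = (\<Sum>c\<in>C. ((\<Sum>r\<in>R. E r c * \<gamma> r) + (\<Sum>s\<in>S. W s c * \<pi> s)) * x c)"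
    by (simp add: sum_distrib_right sum.distrib distrib_right sum.swap[of _ C] mult.assoc mult.commute[of "x _"])
  also have "\<dots> \<le> (\<Sum>c\<in>C. cost c * x c)"
    using dual x by (intro sum_mono mult_right_mono) auto
  finally show ?thesis .
qed

text \<open>
  The objective of the dual of the linearized second stage at \<open>\<omega>\<close>, namely
  \<open>(h - G y)\<^sup>T \<gamma> + (T(\<omega>) y)\<^sup>T \<pi>\<close>.
\<close>

definition dual_value ::
    "('n, 'm, 'e, 'd, 'g) network \<Rightarrow> ('n, 'e, 'd, 'g) linearization \<Rightarrow> (('e, 'g) yvar \<Rightarrow> real) \<Rightarrow>
     real ^ 2 \<Rightarrow> (('n, 'm, 'e, 'd, 'g) row \<Rightarrow> real) \<Rightarrow> ('d \<Rightarrow> real) \<Rightarrow> real" where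
  "dual_value N L y \<omega> \<gamma> \<pi> =
     (\<Sum>r\<in>rows N L. (h_vec r - (\<Sum>k\<in>yvars N. G_mat r k * y k)) * \<gamma> r) +
     (\<Sum>e\<in>dc_edges N. (\<Sum>k\<in>yvars N. (\<Sum>i\<in>UNIV. T_mat N i e k * \<omega> $ i) * y k) * \<pi> e)"

lemma dual_value_le_primal:
  assumes "x \<in> lin_second_stage N L y \<omega>" "dual_feasible N L \<gamma> \<pi>"
  shows "dual_value N L y \<omega> \<gamma> \<pi> \<le> (\<Sum>c\<in>cols N. c_vec N c * x c)"
  unfolding dual_value_def
proof (rule weak_duality[where E = E_mat and W = "W_mat N"])
  show "\<forall>r\<in>rows N L. h_vec r - (\<Sum>k\<in>yvars N. G_mat r k * y k) \<le> (\<Sum>c\<in>cols N. E_mat r c * x c)"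
    using assms(1) by (simp add: lin_second_stage_def diff_le_eq add.commute)
qed (use assms in \<open>simp_all add: lin_second_stage_def dual_feasible_def\<close>)

text \<open>
  The lifted point respects the McCormick bounds on DC voltage differences only if the operating
  point does, so \<open>H\<^sub>o\<close> is first rewritten as the infimum over such operating points.
\<close>

lemma dual_value_le_H_o:
  assumes "wf_network N" "valid_w_bounds N L" "valid_cone_cuts N L" "valid_dv_bounds N L \<nu>"
    and "first_stage N za zg \<rho>" "\<omega> \<in> Omega \<nu>" "dual_feasible N L \<gamma> \<pi>"
  shows "ereal (dual_value N L (first_stage_point za zg \<rho>) \<omega> \<gamma> \<pi>) \<le> H_o N za zg \<rho> \<omega>"
proof -
  have eq: "H_o N za zg \<rho> \<omega> = (INF s\<in>{s \<in> second_stage N za zg \<rho> \<omega>. \<forall>e\<in>dc_edges N.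
      ds_vd s (dsrc N e) - ds_vd s (ddst N e) \<in> {dv_lo L e..dv_hi L e}}. ereal (second_cost N s))"
    by (rule assms(4)[unfolded valid_dv_bounds_def, rule_format, OF assms(5,6), symmetric])
  show ?thesis
    unfolding eq
  proof (rule INF_greatest, clarify)
    fix s
    assume s: "s \<in> second_stage N za zg \<rho> \<omega>"
      "\<forall>e\<in>dc_edges N. ds_vd s (dsrc N e) - ds_vd s (ddst N e) \<in> {dv_lo L e..dv_hi L e}"
    then have "gen_constraints N zg \<rho> s" by (simp add: second_stage_def)
    from lifted_point_cost_le[OF assms(1,5) this]
    show "ereal (dual_value N L (first_stage_point za zg \<rho>) \<omega> \<gamma> \<pi>) \<le> ereal (second_cost N s)"
      using dual_value_le_primal[OF lifted_point_feasible[OF assms(1-3,5) s] assms(7)] by simp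
  qed
qed

lemma H_o_nonneg:
  assumes "wf_network N"
  shows "0 \<le> H_o N za zg \<rho> \<omega>"
proof -
  have "0 \<le> second_cost N s" if "s \<in> second_stage N za zg \<rho> \<omega>" for s
  proof -
    have "\<And>i. i \<in> gens N \<Longrightarrow> 0 \<le> costR1 N i \<and> 0 \<le> costR2 N i"
      "\<And>i. i \<in> ac_nodes N \<Longrightarrow> 0 \<le> shed_cost N i"
      using assms unfolding wf_network_def by simp_all
    moreover have "\<And>i. i \<in> gens N \<Longrightarrow> 0 \<le> ds_Delta s i"
      "\<And>i. i \<in> ac_nodes N \<Longrightarrow> 0 \<le> ds_lp_plus s i \<and> 0 \<le> ds_lp_minus s i
        \<and> 0 \<le> ds_lq_plus s i \<and> 0 \<le> ds_lq_minus s i"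
      using that by (simp_all add: second_stage_def gen_constraints_def node_constraints_def)
    ultimately show ?thesis unfolding second_cost_def by (simp add: sum_nonneg)
  qed
  then show ?thesis unfolding H_o_def by (intro INF_greatest) simp
qed

text \<open>
  The binaries \<open>\<beta>\<close> sum to 1, so they are the indicator of one vertex \<open>j\<close>, and then \<open>\<omega> = j\<close> and
  \<open>\<zeta>\<close> is \<open>\<pi>\<close> at \<open>j\<close> and 0 elsewhere.
\<close>

lemma V_objective_at_vertex:
  assumes fin: "finite (vertices D)" and feas: "V_feasible N L D \<pi>lo \<pi>hi \<gamma> \<pi> \<omega> \<beta> \<zeta>"
  obtains j where "j \<in> vertices D" "V_objective N L D y lam \<gamma> \<omega> \<zeta> = dual_value N L y j \<gamma> \<pi> - lam \<bullet> j"
proof -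
  have \<zeta>: "\<zeta> j e = \<beta> j * \<pi> e" if "j \<in> vertices D" "e \<in> dc_edges N" for j e
    using feas that unfolding V_feasible_def by (intro mccormick_binary) auto
  have \<omega>: "\<omega> = (\<Sum>j\<in>vertices D. \<beta> j *\<^sub>R j)" and sum: "(\<Sum>j\<in>vertices D. \<beta> j) = 1"
    and bin: "\<And>j. j \<in> vertices D \<Longrightarrow> \<beta> j \<in> {0, 1}"
    using feas unfolding V_feasible_def by blast+
  obtain j where j: "j \<in> vertices D" "\<beta> j = 1"
    using sum bin sum.neutral[of "vertices D" \<beta>] by fastforce
  have "(\<Sum>k\<in>vertices D - {j}. \<beta> k) = 0"
    using sum j sum.remove[OF fin j(1), of \<beta>] by simp
  then have "\<beta> k = 0" if "k \<in> vertices D - {j}" for k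
    using that fin bin by (subst (asm) sum_nonneg_eq_0_iff) force+
  then have \<beta>: "\<beta> k = unit_at j k" if "k \<in> vertices D" for k
    using that j by (auto simp: unit_at_def)
  have "\<omega> = (\<Sum>k\<in>vertices D. if k = j then k else 0)"
    unfolding \<omega> by (intro sum.cong refl) (simp add: \<beta> unit_at_def)
  then have "\<omega> = j" using j(1) fin by simp
  moreover have "(\<Sum>k\<in>vertices D. (\<Sum>e\<in>dc_edges N. T_mat N i e v * \<zeta> k e) * k $ i)
      = (\<Sum>e\<in>dc_edges N. T_mat N i e v * \<pi> e) * j $ i" for i v
  proof -
    have "(\<Sum>k\<in>vertices D. (\<Sum>e\<in>dc_edges N. T_mat N i e v * \<zeta> k e) * k $ i)
       = (\<Sum>k\<in>vertices D. unit_at j k * ((\<Sum>e\<in>dc_edges N. T_mat N i e v * \<pi> e) * k $ i))"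
      by (intro sum.cong refl) (simp add: \<zeta> \<beta> sum_distrib_left mult_ac cong: sum.cong)
    then show ?thesis by (simp add: sum_unit_at fin j(1))
  qed
  ultimately have "V_objective N L D y lam \<gamma> \<omega> \<zeta> =
      (\<Sum>r\<in>rows N L. (h_vec r - (\<Sum>k\<in>yvars N. G_mat r k * y k)) * \<gamma> r) +
      (\<Sum>k\<in>yvars N. y k * (\<Sum>i\<in>UNIV. (\<Sum>e\<in>dc_edges N. T_mat N i e k * \<pi> e) * j $ i)) - lam \<bullet> j"
    unfolding V_objective_def by simp
  also have "(\<Sum>k\<in>yvars N. y k * (\<Sum>i\<in>UNIV. (\<Sum>e\<in>dc_edges N. T_mat N i e k * \<pi> e) * j $ i))
      = (\<Sum>k\<in>yvars N. \<Sum>e\<in>dc_edges N. (\<Sum>i\<in>UNIV. T_mat N i e k * j $ i) * y k * \<pi> e)"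
    by (intro sum.cong refl)
       (simp add: sum_2 sum_distrib_left sum_distrib_right sum.distrib distrib_left distrib_right mult_ac)
  also have "\<dots> = (\<Sum>e\<in>dc_edges N. (\<Sum>k\<in>yvars N. (\<Sum>i\<in>UNIV. T_mat N i e k * j $ i) * y k) * \<pi> e)"
    unfolding sum_distrib_right by (rule sum.swap)
  finally have "V_objective N L D y lam \<gamma> \<omega> \<zeta> = dual_value N L y j \<gamma> \<pi> - lam \<bullet> j"
    unfolding dual_value_def .
  with j(1) show thesis by (rule that)
qed

section \<open>The lower bound\<close>

theorem proposition2:
  fixes N :: "('n, 'm, 'e, 'd, 'g) network"
    and L :: "('n, 'e, 'd, 'g) linearization"
    and \<nu> :: real and \<mu> :: "real ^ 2"
    and \<Omega>' :: "(real ^ 2) set"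
    and \<pi>lo \<pi>hi :: "'d \<Rightarrow> real"
  assumes "wf_network N"
    and "0 < \<nu>"
    and "wf_sample_points N L"
    and "valid_w_bounds N L"
    and "valid_cone_cuts N L"
    and "valid_dv_bounds N L \<nu>"
    and "\<And>za zg \<rho>. first_stage N za zg \<rho> \<Longrightarrow> H_o N za zg \<rho> \<in> borel_measurable borel"
    and "\<And>y \<omega>. y_feasible N L y \<Longrightarrow> \<omega> \<in> Omega \<nu> \<Longrightarrow> lin_second_stage N L y \<omega> \<noteq> {}"
    and "\<exists>\<gamma> \<pi>. dual_feasible N L \<gamma> \<pi>"
    and "polyhedron \<Omega>'" and "bounded \<Omega>'" and "\<Omega>' \<noteq> {}" and "\<Omega>' \<subseteq> Omega \<nu>"
  shows "Q_v N L \<Omega>' \<pi>lo \<pi>hi \<mu> \<le> Q_o N \<nu> \<mu>"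
proof -
  have fin: "finite (vertices \<Omega>')"
    using finite_polyhedron_extreme_points[OF assms(10)] by (simp add: vertices_def)
  have vert: "vertices \<Omega>' \<subseteq> Omega \<nu>"
    using assms(13) by (auto simp: vertices_def extreme_point_of_def)
  have "Q_v N L \<Omega>' \<pi>lo \<pi>hi \<mu> \<le>
      ereal (\<Sum>i\<in>gens N. zg i * cost0 N i + cost1 N i * \<rho> i + cost2 N i * (\<rho> i)\<^sup>2) +
      (SUP P\<in>ambiguity \<nu> \<mu>. ereal_expectation P (H_o N za zg \<rho>))" (is "_ \<le> ereal ?c + ?S")
    if fs: "first_stage N za zg \<rho>" for za zg \<rho>
  proof -
    define y where "y = first_stage_point za zg \<rho>"
    have y: "y_feasible N L y" unfolding y_def by (rule first_stage_point_feasible[OF fs])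
    define F where "F = {(\<gamma>, \<pi>). dual_feasible N L \<gamma> \<pi>}"
    \<comment> \<open>\<open>h j\<close> is a supremum of reals, which needs both bounds: \<open>F\<close> is nonempty, and a feasible
      primal point at \<open>j\<close> bounds the dual values.\<close>
    define h where "h = (\<lambda>j. SUP (\<gamma>, \<pi>)\<in>F. dual_value N L y j \<gamma> \<pi>)"
    have F: "F \<noteq> {}" using assms(9) by (auto simp: F_def)
    have le_h: "dual_value N L y j \<gamma> \<pi> \<le> h j" if "j \<in> vertices \<Omega>'" "dual_feasible N L \<gamma> \<pi>" for j \<gamma> \<pi>
    proof -
      obtain x where "x \<in> lin_second_stage N L y j" using assms(8)[OF y, of j] vert \<open>j \<in> vertices \<Omega>'\<close> by auto
      then have "bdd_above ((\<lambda>(\<gamma>, \<pi>). dual_value N L y j \<gamma> \<pi>) ` F)"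
        by (intro bdd_aboveI2[of _ _ "\<Sum>c\<in>cols N. c_vec N c * x c"])
           (auto simp: F_def intro: dual_value_le_primal)
      from cSUP_upper[OF _ this, of "(\<gamma>, \<pi>)"] show ?thesis using that(2) by (simp add: F_def h_def)
    qed
    have h_le: "ereal (h j) \<le> H_o N za zg \<rho> j" if "j \<in> vertices \<Omega>'" for j
    proof -
      have *: "ereal (dual_value N L y j \<gamma> \<pi>) \<le> H_o N za zg \<rho> j" if "(\<gamma>, \<pi>) \<in> F" for \<gamma> \<pi>
        using dual_value_le_H_o[OF assms(1,4-6) fs] vert \<open>j \<in> vertices \<Omega>'\<close> that
        by (auto simp: F_def y_def)
      show ?thesis
      proof (cases "H_o N za zg \<rho> j")
        case (real t)
        then show ?thesis unfolding h_def using * F by (auto intro!: cSUP_least)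
      qed (use H_o_nonneg[OF assms(1), of za zg \<rho> j] in auto)
    qed
    have bound: "Q_v N L \<Omega>' \<pi>lo \<pi>hi \<mu> \<le> ereal (?c + T)" if T: "?S < ereal T" for T
    proof -
      have "(\<Sum>j\<in>vertices \<Omega>'. p j * h j) < T"
        if p: "\<forall>j\<in>vertices \<Omega>'. 0 \<le> p j" "sum p (vertices \<Omega>') = 1" "(\<Sum>j\<in>vertices \<Omega>'. p j *\<^sub>R j) = \<mu>" for p
      proof -
        obtain P where "P \<in> ambiguity \<nu> \<mu>"
          "ereal (\<Sum>j\<in>vertices \<Omega>'. p j * h j) \<le> ereal_expectation P (H_o N za zg \<rho>)"
          using discrete_distribution_expectation[OF fin p vert assms(7)[OF fs] H_o_nonneg[OF assms(1)] h_le]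
          by blast
        then have "ereal (\<Sum>j\<in>vertices \<Omega>'. p j * h j) \<le> ?S" by (rule SUP_upper2)
        also note T
        finally show ?thesis by simp
      qed
      from finite_moment_duality[OF fin this] obtain lam
        where lam: "\<forall>j\<in>vertices \<Omega>'. h j - lam \<bullet> j \<le> T - lam \<bullet> \<mu>" by blast
      define \<eta> where "\<eta> = T - lam \<bullet> \<mu>"
      have "V_value N L \<Omega>' \<pi>lo \<pi>hi y lam \<le> ereal \<eta>"
        unfolding V_value_def
      proof (rule Sup_least, clarify)
        fix \<gamma> \<pi> \<omega> \<beta> \<zeta>
        assume feas: "V_feasible N L \<Omega>' \<pi>lo \<pi>hi \<gamma> \<pi> \<omega> \<beta> \<zeta>"
        obtain j where j: "j \<in> vertices \<Omega>'"
          "V_objective N L \<Omega>' y lam \<gamma> \<omega> \<zeta> = dual_value N L y j \<gamma> \<pi> - lam \<bullet> j"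
          using V_objective_at_vertex[OF fin feas] .
        have "dual_value N L y j \<gamma> \<pi> \<le> h j"
          using feas by (intro le_h j(1)) (simp add: V_feasible_def)
        then show "ereal (V_objective N L \<Omega>' y lam \<gamma> \<omega> \<zeta>) \<le> ereal \<eta>"
          using lam j by (force simp: \<eta>_def)
      qed
      with y have "Q_v N L \<Omega>' \<pi>lo \<pi>hi \<mu> \<le> ereal (y_cost N y + \<mu> \<bullet> lam + \<eta>)"
        unfolding Q_v_def by (intro INF_lower2[of "(y, lam, \<eta>)"]) auto
      also have "y_cost N y + \<mu> \<bullet> lam + \<eta> = ?c + T"
        by (simp add: \<eta>_def y_cost_def y_def inner_commute)
      finally show ?thesis .
    qed
    show ?thesis
    proof (rule ereal_le_real)
      fix B assume "ereal ?c + ?S \<le> ereal B"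
      then have S: "?S \<le> ereal (B - ?c)" by (cases ?S) auto
      show "Q_v N L \<Omega>' \<pi>lo \<pi>hi \<mu> \<le> ereal B"
      proof (rule ereal_le_epsilon2)
        fix \<epsilon> :: real assume "0 < \<epsilon>"
        then have "?S < ereal (B - ?c + \<epsilon>)"
          using S by (auto intro: le_less_trans)
        from bound[OF this] show "Q_v N L \<Omega>' \<pi>lo \<pi>hi \<mu> \<le> ereal B + ereal \<epsilon>" by simp
      qed
    qed
  qed
  then show ?thesis unfolding Q_o_def by (intro INF_greatest) auto
qed

end
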